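(* Let $\mathcal{H}$ be a complex Hilbert space, $\mathcal{D}$ a dense subspace of $\mathcal{H}$ and $\Omega$ a solvable sesquilinear form on $\mathcal{D}$ with associated operator $T$. Then $T$ is self-adjoint if and only if $\Omega$ is symmetric.
   Context: Let $\langle\cdot|\cdot\rangle$ and $\|\cdot\|$ be the inner product and norm of $\mathcal{H}$. Sesquilinear forms are linear in the first variable and conjugate linear in the second. A form $\Omega$ on $\mathcal{D}$ is symmetric if $\Omega(\xi,\eta)=\overline{\Omega(\eta,\xi)}$ for all $\xi,\eta\in\mathcal{D}$. A sesquilinear form $\Omega$ on the dense subspace $\mathcal{D}$ is q-closed with respect to a norm $\|\cdot\|_\Omega$ on $\mathcal{D}$ if: (1) there is $\alpha>0$ with $\|\xi\|\le\alpha\|\xi\|_\Omega$ for all $\xi\in\mathcal{D}$; (2) if $\{\xi_n\}\subset\mathcal{D}$, $\|\xi_n\|\to0$ and $\|\xi_n-\xi_m\|_\Omega\to0$, then $\|\xi_n\|_\Omega\to0$; (3) $\mathcal{E}_\Omega:=\mathcal{D}[\|\cdot\|_\Omega]$ is a reflexive Banach space; (4) there is $\beta>0$ with $|\Omega(\xi,\eta)|\le\beta\|\xi\|_\Omega\|\eta\|_\Omega$ for all $\xi,\eta\in\mathcal{D}$. Let $\mathcal{E}_\Omega^\times$ be the conjugate dual of $\mathcal{E}_\Omega$ (bounded conjugate linear functionals). For $\Omega$ q-closed with respect to $\|\cdot\|_\Omega$, $\mathfrak{P}(\Omega)$ is the set of bounded sesquilinear forms $\Upsilon$ on $\mathcal{H}$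 such that (i) if $\xi\in\mathcal{D}$ and $(\Omega+\Upsilon)(\xi,\eta)=0$ for all $\eta\in\mathcal{D}$, then $\xi=0$; (ii) for every $\Lambda\in\mathcal{E}_\Omega^\times$ there is $\xi\in\mathcal{D}$ with $\Lambda(\eta)=(\Omega+\Upsilon)(\xi,\eta)$ for all $\eta\in\mathcal{D}$. $\Omega$ is solvable with respect to $\|\cdot\|_\Omega$ if it is q-closed with respect to $\|\cdot\|_\Omega$ and $\mathfrak{P}(\Omega)\neq\varnothing$; it is solvable if it is solvable with respect to some norm on $\mathcal{D}$. The operator associated to a solvable form $\Omega$ is the (closed, densely defined) operator $T$ with $D(T)=\{\xi\in\mathcal{D}:\exists\,\chi\in\mathcal{H}\text{ with }\Omega(\xi,\eta)=\langle\chi|\eta\rangle\ \forall\eta\in\mathcal{D}\}$ and $T\xi=\chi$; it is the greatest operator $T$ with $D(T)\subseteq\mathcal{D}$ and $\Omega(\xi,\eta)=\langle T\xi|\eta\rangle$ for all $\xi\in D(T)$, $\eta\in\mathcal{D}$. *)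

theory Defs
  imports "HOL-Analysis.Analysis"
begin

section \<open>Complex Hilbert spaces\<close>

text \<open>The inner product is linear in the first and conjugate linear in the second argument.\<close>

class complex_hilbert = banach +
  fixes scaleC :: "complex \<Rightarrow> 'a \<Rightarrow> 'a" (infixr \<open>*\<^sub>C\<close> 75)
    and cinner :: "'a \<Rightarrow> 'a \<Rightarrow> complex"
  assumes scaleC_add_right: "c *\<^sub>C (x + y) = c *\<^sub>C x + c *\<^sub>C y"
    and scaleC_add_left: "(c + d) *\<^sub>C x = c *\<^sub>C x + d *\<^sub>C x"
    and scaleC_scaleC: "c *\<^sub>C d *\<^sub>C x = (c * d) *\<^sub>C x"
    and scaleC_one: "1 *\<^sub>C x = x"
    and scaleR_scaleC: "r *\<^sub>R x = complex_of_real r *\<^sub>C x"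
    and cinner_commute: "cinner x y = cnj (cinner y x)"
    and cinner_add_left: "cinner (x + y) z = cinner x z + cinner y z"
    and cinner_scaleC_left: "cinner (c *\<^sub>C x) y = c * cinner x y"
    and cinner_nonneg: "0 \<le> Re (cinner x x)"
    and cinner_eq_zero_iff: "cinner x x = 0 \<longleftrightarrow> x = 0"
    and norm_eq_sqrt_cinner: "norm x = sqrt (Re (cinner x x))"

global_interpretation complex_vector: vector_space "scaleC :: complex \<Rightarrow> 'a \<Rightarrow> 'a::complex_hilbert"
  by unfold_locales
    (simp_all add: scaleC_add_right scaleC_add_left scaleC_scaleC scaleC_one)

abbreviation dense_subspace :: "'a::complex_hilbert set \<Rightarrow> bool" where
  "dense_subspace D \<equiv> complex_vector.subspace D \<and> closure D = UNIV"


section \<open>Normed subspaces and their duals\<close>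

text \<open>A subspace \<open>D\<close> is equipped with a norm \<open>N\<close> that is in general not the ambient one. Only the
  values of \<open>N\<close>, of forms and of functionals on \<open>D\<close> are relevant.\<close>

definition norm_on :: "'a::complex_hilbert set \<Rightarrow> ('a \<Rightarrow> real) \<Rightarrow> bool" where
  "norm_on D N \<longleftrightarrow>
     (\<forall>x\<in>D. 0 \<le> N x) \<and>
     (\<forall>x\<in>D. N x = 0 \<longleftrightarrow> x = 0) \<and>
     (\<forall>c. \<forall>x\<in>D. N (c *\<^sub>C x) = cmod c * N x) \<and>
     (\<forall>x\<in>D. \<forall>y\<in>D. N (x + y) \<le> N x + N y)"

text \<open>The library's metric spaces require a distance that is nonnegative and symmetric on the
  whole type, hence the value zero off \<open>D\<close>.\<close>

definition norm_dist :: "'a::complex_hilbert set \<Rightarrow> ('a \<Rightarrow> real) \<Rightarrow> 'a \<Rightarrow> 'a \<Rightarrow> real" where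
  "norm_dist D N x y = (if x \<in> D \<and> y \<in> D then N (x - y) else 0)"

lemma Metric_space_norm_dist:
  assumes D: "complex_vector.subspace D" and N: "norm_on D N"
  shows "Metric_space D (norm_dist D N)"
proof
  have diff: "x - y \<in> D" if "x \<in> D" "y \<in> D" for x y
    using D that by (rule complex_vector.subspace_diff)
  have pos: "0 \<le> N x" and zero: "N x = 0 \<longleftrightarrow> x = 0"
    and scale: "N (c *\<^sub>C x) = cmod c * N x" if "x \<in> D" for c x
    using N that by (simp_all only: norm_on_def)
  have triangle: "N (x + y) \<le> N x + N y" if "x \<in> D" "y \<in> D" for x y
    using N that by (simp only: norm_on_def)
  have sym: "N (x - y) = N (y - x)" if "x \<in> D" "y \<in> D" for x y
    using scale[OF diff[OF that(2,1)], of "-1"] by simp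
  show "0 \<le> norm_dist D N x y" for x y
    using pos[OF diff] by (simp add: norm_dist_def)
  show "norm_dist D N x y = norm_dist D N y x" for x y
    using sym by (simp add: norm_dist_def)
  show "norm_dist D N x y = 0 \<longleftrightarrow> x = y" if "x \<in> D" "y \<in> D" for x y
    using zero[OF diff[OF that]] that by (simp add: norm_dist_def)
  show "norm_dist D N x z \<le> norm_dist D N x y + norm_dist D N y z"
    if xyz: "x \<in> D" "y \<in> D" "z \<in> D" for x y z
    using triangle[OF diff[OF xyz(1,2)] diff[OF xyz(2,3)]] xyz by (simp add: norm_dist_def)
qed

definition banach_on :: "'a::complex_hilbert set \<Rightarrow> ('a \<Rightarrow> real) \<Rightarrow> bool" where
  "banach_on D N \<longleftrightarrow> Metric_space.mcomplete D (norm_dist D N)"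

text \<open>Functionals in the dual are set to zero outside \<open>D\<close>, so that they are determined by their
  restriction to \<open>D\<close>.\<close>

definition dual_on :: "'a::complex_hilbert set \<Rightarrow> ('a \<Rightarrow> real) \<Rightarrow> ('a \<Rightarrow> complex) set" where
  "dual_on D N = {f.
     (\<forall>x\<in>D. \<forall>y\<in>D. f (x + y) = f x + f y) \<and>
     (\<forall>c. \<forall>x\<in>D. f (c *\<^sub>C x) = c * f x) \<and>
     (\<exists>K. \<forall>x\<in>D. cmod (f x) \<le> K * N x) \<and>
     (\<forall>x. x \<notin> D \<longrightarrow> f x = 0)}"

definition dual_norm_on :: "'a::complex_hilbert set \<Rightarrow> ('a \<Rightarrow> real) \<Rightarrow> ('a \<Rightarrow> complex) \<Rightarrow> real" where
  "dual_norm_on D N f = (SUP x\<in>{x\<in>D. N x \<le> 1}. cmod (f x))"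

definition bidual_on ::
  "'a::complex_hilbert set \<Rightarrow> ('a \<Rightarrow> real) \<Rightarrow> (('a \<Rightarrow> complex) \<Rightarrow> complex) set" where
  "bidual_on D N = {F.
     (\<forall>f\<in>dual_on D N. \<forall>g\<in>dual_on D N. F (\<lambda>x. f x + g x) = F f + F g) \<and>
     (\<forall>c. \<forall>f\<in>dual_on D N. F (\<lambda>x. c * f x) = c * F f) \<and>
     (\<exists>K. \<forall>f\<in>dual_on D N. cmod (F f) \<le> K * dual_norm_on D N f)}"

text \<open>Reflexivity: the canonical embedding into the bidual is onto.\<close>

definition reflexive_on :: "'a::complex_hilbert set \<Rightarrow> ('a \<Rightarrow> real) \<Rightarrow> bool" where
  "reflexive_on D N \<longleftrightarrow> (\<forall>F\<in>bidual_on D N. \<exists>x\<in>D. \<forall>f\<in>dual_on D N. F f = f x)"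

definition conj_dual_on :: "'a::complex_hilbert set \<Rightarrow> ('a \<Rightarrow> real) \<Rightarrow> ('a \<Rightarrow> complex) set" where
  "conj_dual_on D N = {f.
     (\<forall>x\<in>D. \<forall>y\<in>D. f (x + y) = f x + f y) \<and>
     (\<forall>c. \<forall>x\<in>D. f (c *\<^sub>C x) = cnj c * f x) \<and>
     (\<exists>K. \<forall>x\<in>D. cmod (f x) \<le> K * N x) \<and>
     (\<forall>x. x \<notin> D \<longrightarrow> f x = 0)}"


section \<open>Sesquilinear forms\<close>

definition sesquilinear_on ::
  "'a::complex_hilbert set \<Rightarrow> ('a \<Rightarrow> 'a \<Rightarrow> complex) \<Rightarrow> bool" where
  "sesquilinear_on D W \<longleftrightarrow>
     (\<forall>x\<in>D. \<forall>y\<in>D. \<forall>z\<in>D. W (x + y) z = W x z + W y z) \<and>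
     (\<forall>c. \<forall>x\<in>D. \<forall>y\<in>D. W (c *\<^sub>C x) y = c * W x y) \<and>
     (\<forall>x\<in>D. \<forall>y\<in>D. \<forall>z\<in>D. W x (y + z) = W x y + W x z) \<and>
     (\<forall>c. \<forall>x\<in>D. \<forall>y\<in>D. W x (c *\<^sub>C y) = cnj c * W x y)"

definition symmetric_on ::
  "'a::complex_hilbert set \<Rightarrow> ('a \<Rightarrow> 'a \<Rightarrow> complex) \<Rightarrow> bool" where
  "symmetric_on D W \<longleftrightarrow> (\<forall>x\<in>D. \<forall>y\<in>D. W x y = cnj (W y x))"

definition bounded_sesquilinear :: "('a::complex_hilbert \<Rightarrow> 'a \<Rightarrow> complex) \<Rightarrow> bool" where
  "bounded_sesquilinear Y \<longleftrightarrow>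
     sesquilinear_on UNIV Y \<and> (\<exists>K. \<forall>x y. cmod (Y x y) \<le> K * norm x * norm y)"

definition q_closed ::
  "'a::complex_hilbert set \<Rightarrow> ('a \<Rightarrow> 'a \<Rightarrow> complex) \<Rightarrow> ('a \<Rightarrow> real) \<Rightarrow> bool" where
  "q_closed D W N \<longleftrightarrow>
     (\<exists>\<alpha>>0. \<forall>x\<in>D. norm x \<le> \<alpha> * N x) \<and>
     (\<forall>X. Metric_space.MCauchy D (norm_dist D N) X \<longrightarrow> (\<lambda>n. norm (X n)) \<longlonglongrightarrow> 0
        \<longrightarrow> (\<lambda>n. N (X n)) \<longlonglongrightarrow> 0) \<and>
     banach_on D N \<and> reflexive_on D N \<and>
     (\<exists>\<beta>>0. \<forall>x\<in>D. \<forall>y\<in>D. cmod (W x y) \<le> \<beta> * N x * N y)"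

definition perturbations ::
  "'a::complex_hilbert set \<Rightarrow> ('a \<Rightarrow> 'a \<Rightarrow> complex) \<Rightarrow> ('a \<Rightarrow> real) \<Rightarrow> ('a \<Rightarrow> 'a \<Rightarrow> complex) set" where
  "perturbations D W N = {Y. bounded_sesquilinear Y \<and>
     (\<forall>x\<in>D. (\<forall>y\<in>D. W x y + Y x y = 0) \<longrightarrow> x = 0) \<and>
     (\<forall>f\<in>conj_dual_on D N. \<exists>x\<in>D. \<forall>y\<in>D. f y = W x y + Y x y)}"

definition solvable_wrt ::
  "'a::complex_hilbert set \<Rightarrow> ('a \<Rightarrow> 'a \<Rightarrow> complex) \<Rightarrow> ('a \<Rightarrow> real) \<Rightarrow> bool" where
  "solvable_wrt D W N \<longleftrightarrow> q_closed D W N \<and> perturbations D W N \<noteq> {}"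

definition solvable :: "'a::complex_hilbert set \<Rightarrow> ('a \<Rightarrow> 'a \<Rightarrow> complex) \<Rightarrow> bool" where
  "solvable D W \<longleftrightarrow> (\<exists>N. norm_on D N \<and> solvable_wrt D W N)"


section \<open>Unbounded operators\<close>

text \<open>An operator is given by its domain \<open>S\<close> together with a function \<open>T\<close> whose values outside
  \<open>S\<close> are irrelevant. The definite descriptions below are well defined when \<open>S\<close>, respectively
  \<open>D\<close>, is dense.\<close>

definition densely_defined_operator ::
  "'a::complex_hilbert set \<Rightarrow> ('a \<Rightarrow> 'a) \<Rightarrow> bool" where
  "densely_defined_operator S T \<longleftrightarrow> dense_subspace S \<and>
     (\<forall>x\<in>S. \<forall>y\<in>S. T (x + y) = T x + T y) \<and>
     (\<forall>c. \<forall>x\<in>S. T (c *\<^sub>C x) = c *\<^sub>C T x)"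

definition adjoint_dom :: "'a::complex_hilbert set \<Rightarrow> ('a \<Rightarrow> 'a) \<Rightarrow> 'a set" where
  "adjoint_dom S T = {y. \<exists>z. \<forall>x\<in>S. cinner (T x) y = cinner x z}"

definition adjoint_op :: "'a::complex_hilbert set \<Rightarrow> ('a \<Rightarrow> 'a) \<Rightarrow> 'a \<Rightarrow> 'a" where
  "adjoint_op S T y = (THE z. \<forall>x\<in>S. cinner (T x) y = cinner x z)"

definition self_adjoint :: "'a::complex_hilbert set \<Rightarrow> ('a \<Rightarrow> 'a) \<Rightarrow> bool" where
  "self_adjoint S T \<longleftrightarrow> densely_defined_operator S T \<and>
     adjoint_dom S T = S \<and> (\<forall>x\<in>S. adjoint_op S T x = T x)"

definition form_dom ::
  "'a::complex_hilbert set \<Rightarrow> ('a \<Rightarrow> 'a \<Rightarrow> complex) \<Rightarrow> 'a set" where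
  "form_dom D W = {x\<in>D. \<exists>z. \<forall>y\<in>D. W x y = cinner z y}"

definition form_op ::
  "'a::complex_hilbert set \<Rightarrow> ('a \<Rightarrow> 'a \<Rightarrow> complex) \<Rightarrow> 'a \<Rightarrow> 'a" where
  "form_op D W x = (THE z. \<forall>y\<in>D. W x y = cinner z y)"

end

theory Submission
  imports Defs
begin

text \<open>Fix a perturbation \<open>Y\<close> and let \<open>\<Phi> = \<Omega> + Y\<close>. The map \<open>x \<mapsto> \<Phi>(x, \<cdot>)\<close> is an isomorphism from \<open>D\<close> with
  its norm onto the conjugate dual, so by reflexivity every bounded linear functional on \<open>D\<close> is
  \<open>\<Phi>(\<cdot>, y)\<close> for some \<open>y \<in> D\<close>. Writing \<open>Y(x, y) = \<langle>B x | y\<rangle>\<close>, the operator \<open>T + B\<close> is onto, hence such a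
  \<open>y\<close> is determined by the values \<open>\<Phi>(x, y)\<close> with \<open>x\<close> in the domain of \<open>T\<close>. For \<open>y\<close> in the domain of
  \<open>T\<^sup>*\<close>, comparing with the representative of \<open>x \<mapsto> \<langle>x | T\<^sup>* y\<rangle> + Y(x, y)\<close> gives \<open>y \<in> D\<close> and
  \<open>\<Omega>(x, y) = \<langle>x | T\<^sup>* y\<rangle>\<close> for all \<open>x \<in> D\<close>; symmetry then puts \<open>y\<close> in the domain of \<open>T\<close>. Conversely,
  if \<open>T\<close> is self-adjoint this identity shows symmetry whenever one argument lies in the domain of
  \<open>T\<close>, and for arbitrary \<open>y \<in> D\<close> one compares \<open>y\<close> with the representative of
  \<open>x \<mapsto> cnj (\<Omega>(y, x)) + Y(x, y)\<close>.\<close>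

section \<open>Complete norms on a subspace\<close>

lemmas csub_add = complex_vector.subspace_add
lemmas csub_diff = complex_vector.subspace_diff
lemmas csub_scale = complex_vector.subspace_scale
lemmas csub_0 = complex_vector.subspace_0

lemma scaleR_in_subspace: "complex_vector.subspace D \<Longrightarrow> x \<in> D \<Longrightarrow> r *\<^sub>R x \<in> D"
  by (simp add: scaleR_scaleC csub_scale)

lemma norm_onD:
  assumes "norm_on D N" "x \<in> D"
  shows "0 \<le> N x" "N x = 0 \<longleftrightarrow> x = 0" "N (c *\<^sub>C x) = cmod c * N x" "N (r *\<^sub>R x) = \<bar>r\<bar> * N x"
    "y \<in> D \<Longrightarrow> N (x + y) \<le> N x + N y"
  using assms by (simp_all add: norm_on_def scaleR_scaleC)

lemma norm_on_commute:
  assumes "complex_vector.subspace D" "norm_on D N" "x \<in> D" "y \<in> D"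
  shows "N (x - y) = N (y - x)"
  using norm_onD(4)[OF assms(2) csub_diff[OF assms(1,3,4)], of "-1"] by simp

text \<open>On \<open>D\<close> the distance \<open>norm_dist D N\<close> is
  \<open>N (x - y)\<close>, which turns the library's metric completeness into a statement about
  sequences and \<open>N\<close>.\<close>

lemma banach_on_iff:
  assumes D: "complex_vector.subspace D" and N: "norm_on D N"
  shows "banach_on D N \<longleftrightarrow> (\<forall>X. (\<forall>n. X n \<in> D) \<longrightarrow> (\<forall>e>0. \<exists>m. \<forall>i\<ge>m. \<forall>j\<ge>m. N (X i - X j) < e)
    \<longrightarrow> (\<exists>x\<in>D. (\<lambda>n. N (X n - x)) \<longlonglongrightarrow> 0))"
proof -
  interpret Metric_space D "norm_dist D N"
    using D N by (rule Metric_space_norm_dist)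
  have C: "MCauchy X \<longleftrightarrow> (\<forall>n. X n \<in> D) \<and> (\<forall>e>0. \<exists>m. \<forall>i\<ge>m. \<forall>j\<ge>m. N (X i - X j) < e)" for X
    unfolding MCauchy_def by (auto simp: norm_dist_def image_subset_iff)
  have L: "limitin mtopology X x sequentially \<longleftrightarrow> x \<in> D \<and> (\<lambda>n. N (X n - x)) \<longlonglongrightarrow> 0"
    if "\<forall>n. X n \<in> D" for X x
  proof (cases "x \<in> D")
    case True
    have "0 \<le> N (X n - x)" for n
      using csub_diff[OF D] that True N by (meson norm_onD(1))
    with that True show ?thesis
      by (auto simp: limit_metric_sequentially LIMSEQ_iff norm_dist_def)
  qed (simp add: limit_metric_sequentially)
  show ?thesis
    unfolding banach_on_def mcomplete_def C by (intro iff_allI) (auto simp: L)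
qed

text \<open>The first half of the open mapping theorem for the identity from \<open>N\<close> to \<open>M\<close>: completeness
  of \<open>M\<close> alone yields approximate preimages, by Baire's theorem.\<close>

lemma approximate_preimage:
  assumes D: "complex_vector.subspace D" and N: "norm_on D N" and M: "norm_on D M"
    and cM: "banach_on D M"
  shows "\<exists>L\<ge>0. \<forall>x\<in>D. \<forall>e>0. \<exists>u\<in>D. N u \<le> L * M x \<and> M (x - u) < e"
proof -
  interpret Metric_space D "norm_dist D M"
    using D M by (rule Metric_space_norm_dist)
  define A where "A n = mtopology closure_of {x\<in>D. N x \<le> real n}" for n
  have inA: "x \<in> A n \<longleftrightarrow> x \<in> D \<and> (\<forall>e>0. \<exists>u\<in>D. N u \<le> real n \<and> M (x - u) < e)" for x n
    unfolding A_def metric_closure_of by (auto simp: norm_dist_def)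
  \<comment> \<open>The closed sets \<open>A n\<close> cover \<open>D\<close>; if all had empty
    interior, so would \<open>D\<close> by Baire's theorem.\<close>
  have "\<exists>n. mtopology interior_of A n \<noteq> {}"
  proof (rule ccontr)
    assume "\<not> ?thesis"
    then have "mtopology interior_of (\<Union>(range A)) = {}"
      using cM by (intro metric_Baire_category_alt) (auto simp: banach_on_def A_def)
    moreover have "\<Union>(range A) = D"
    proof
      show "\<Union>(range A) \<subseteq> D" by (auto simp: inA)
      show "D \<subseteq> \<Union>(range A)"
      proof
        fix x assume "x \<in> D"
        then have "x \<in> A (nat \<lceil>N x\<rceil>)"
          unfolding inA using norm_onD(2)[OF M csub_0[OF D]]
          by (auto intro!: bexI[of _ x] simp: real_nat_ceiling_ge)
        then show "x \<in> \<Union>(range A)" by blast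
      qed
    qed
    ultimately show False
      using csub_0[OF D] interior_of_topspace[of mtopology] by auto
  qed
  then obtain n a where "a \<in> mtopology interior_of A n" by blast
  then obtain r where r: "r > 0" "a \<in> D" "mball a r \<subseteq> A n"
    by (auto simp: metric_interior_of)
  \<comment> \<open>\<open>x\<close> is the difference of \<open>a + x\<close> and \<open>a\<close>,
    which both lie in the ball contained in \<open>A n\<close>; hence the bound doubles to
    \<open>2 * n\<close>.\<close>
  have small: "\<exists>u\<in>D. N u \<le> 2 * real n \<and> M (x - u) < e"
    if x: "x \<in> D" "M x < r" and e: "e > 0" for x e
  proof -
    have "a \<in> A n" "a + x \<in> A n"
      using r x csub_add[OF D] csub_diff[OF D] norm_on_commute[OF D M, of a "a + x"]
        norm_onD(2)[OF M csub_0[OF D]]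
      by (auto simp: norm_dist_def intro!: subsetD[OF r(3)])
    then obtain u v where u: "u \<in> D" "N u \<le> real n" "M (a + x - u) < e/2"
      and v: "v \<in> D" "N v \<le> real n" "M (a - v) < e/2"
      unfolding inA using e by (meson half_gt_zero)
    have "N (u - v) \<le> N u + N v"
      using norm_onD(5)[OF N u(1), of "-v"] norm_onD(4)[OF N v(1), of "-1"]
        scaleR_in_subspace[OF D v(1), of "-1"] by simp
    moreover have "M (x - (u - v)) \<le> M (a + x - u) + M (v - a)"
      using norm_onD(5)[OF M csub_diff[OF D csub_add[OF D r(2) x(1)] u(1)] csub_diff[OF D v(1) r(2)]]
      by (simp add: algebra_simps)
    moreover have "M (v - a) = M (a - v)"
      using norm_on_commute[OF D M v(1) r(2)] .
    ultimately show ?thesis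
      using u v csub_diff[OF D u(1) v(1)] by (intro bexI[of _ "u - v"]) auto
  qed
  show ?thesis
  proof (intro exI[of _ "4 * real n / r"] conjI ballI allI impI)
    fix x e assume x: "x \<in> D" and e: "(e::real) > 0"
    show "\<exists>u\<in>D. N u \<le> 4 * real n / r * M x \<and> M (x - u) < e"
    proof (cases "x = 0")
      case True
      then show ?thesis
        using x e norm_onD(2)[OF M x] norm_onD(2)[OF N x] by (intro bexI[of _ 0]) auto
    next
      case False
      then have p: "M x > 0"
        using norm_onD(1,2)[OF M x] by fastforce
      \<comment> \<open>\<open>s\<close> scales \<open>x\<close> to \<open>M\<close>-norm
        \<open>r / 2\<close>, where \<open>small\<close> applies. Scaling back divides by
        \<open>s\<close>, which explains the tolerance \<open>s * e\<close> and the constant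
        \<open>4 * n / r\<close>.\<close>
      define s where "s = r / (2 * M x)"
      have s: "s > 0" using p r by (simp add: s_def)
      have "M (s *\<^sub>R x) = r / 2"
        using norm_onD(4)[OF M x, of s] s p r(1) by (simp add: s_def)
      then obtain u where u: "u \<in> D" "N u \<le> 2 * real n" "M (s *\<^sub>R x - u) < s * e"
        using small[of "s *\<^sub>R x" "s * e"] s e r scaleR_in_subspace[OF D x] by auto
      have eq: "x - (1/s) *\<^sub>R u = (1/s) *\<^sub>R (s *\<^sub>R x - u)"
        using s by (simp add: algebra_simps)
      have "M (x - (1/s) *\<^sub>R u) < e"
        using norm_onD(4)[OF M csub_diff[OF D scaleR_in_subspace[OF D x] u(1)], of "1/s" s] u(3) s
        unfolding eq by (simp add: divide_less_eq mult.commute)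
      moreover have "N ((1/s) *\<^sub>R u) \<le> 4 * real n / r * M x"
        using norm_onD(4)[OF N u(1), of "1/s"] u(2) s p r
        by (simp add: s_def field_simps)
      ultimately show ?thesis
        using scaleR_in_subspace[OF D u(1)] by blast
    qed
  qed (use r in auto)
qed

text \<open>The second half of the open mapping argument: approximating the remainder repeatedly
  halves its bound in \<open>M\<close>, while the corrections form a geometrically convergent series
  in \<open>N\<close>. Completeness of \<open>N\<close> sums it, and
  \<open>M x \<le> C * N x\<close> identifies the sum as the original vector.\<close>

lemma complete_norms_equivalent:
  assumes D: "complex_vector.subspace D" and N: "norm_on D N" and M: "norm_on D M"
    and cN: "banach_on D N" and cM: "banach_on D M"
    and le: "\<And>x. x \<in> D \<Longrightarrow> M x \<le> C * N x"
  shows "\<exists>K. \<forall>x\<in>D. N x \<le> K * M x"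
proof -
  obtain L where L: "L \<ge> 0" "\<And>x e. x \<in> D \<Longrightarrow> e > 0 \<Longrightarrow> \<exists>u\<in>D. N u \<le> L * M x \<and> M (x - u) < e"
    using approximate_preimage[OF D N M cM] by blast
  have "N x \<le> 2 * L * M x" if x: "x \<in> D" for x
  proof (cases "x = 0")
    case True
    then show ?thesis using norm_onD(2)[OF M x] norm_onD(2)[OF N x] by simp
  next
    case False
    then have p: "M x > 0"
      using norm_onD(1,2)[OF M x] by fastforce
    define c where "c = L * M x"
    have "\<exists>f. \<forall>k. (f k \<in> D \<and> M (f k) \<le> M x / 2^k) \<and> f 0 = x \<and> N (f k - f (Suc k)) \<le> c / 2^k"
    proof -
      \<comment> \<open>\<open>f k\<close> is the remainder after \<open>k\<close> corrections. The
        clause for \<open>k = 0\<close> fixes the starting value inside the dependent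
        choice.\<close>
      have "\<exists>f. \<forall>k. (f k \<in> D \<and> M (f k) \<le> M x / 2^k \<and> (k = 0 \<longrightarrow> f k = x)) \<and>
          N (f k - f (Suc k)) \<le> c / 2^k"
      proof (rule dependent_nat_choice)
        show "\<exists>y. y \<in> D \<and> M y \<le> M x / 2^0 \<and> (0 = 0 \<longrightarrow> y = x)"
          using x by auto
        fix y k assume y: "y \<in> D \<and> M y \<le> M x / 2^k \<and> (k = 0 \<longrightarrow> y = x)"
        then obtain u where u: "u \<in> D" "N u \<le> L * M y" "M (y - u) < M x / 2 ^ Suc k"
          using L(2)[of y "M x / 2 ^ Suc k"] p by auto
        have "L * M y \<le> c / 2^k"
          using y L(1) mult_left_mono[of "M y" "M x / 2^k" L] by (simp add: c_def)
        with u y show "\<exists>z. (z \<in> D \<and> M z \<le> M x / 2 ^ Suc k \<and> (Suc k = 0 \<longrightarrow> z = x)) \<and> N (y - z) \<le> c / 2^k"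
          by (intro exI[of _ "y - u"]) (auto intro: csub_diff[OF D])
      qed
      then show ?thesis by blast
    qed
    then obtain f where f: "\<And>k. f k \<in> D" "\<And>k. M (f k) \<le> M x / 2^k" "f 0 = x"
      "\<And>k. N (f k - f (Suc k)) \<le> c / 2^k" by blast
    \<comment> \<open>The right side is the closed form of the sum of \<open>c / 2^i\<close> over
      \<open>m \<le> i < m + k\<close>.\<close>
    have step: "N (f m - f (m + k)) \<le> 2 * c / 2^m - 2 * c / 2^(m+k)" for m k
    proof (induction k)
      case 0
      then show ?case using norm_onD(2)[OF N csub_0[OF D]] by simp
    next
      case (Suc k)
      have "N (f m - f (m + Suc k)) \<le> N (f m - f (m + k)) + N (f (m + k) - f (Suc (m + k)))"
        using norm_onD(5)[OF N csub_diff[OF D f(1) f(1)] csub_diff[OF D f(1) f(1)],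
            of m "m + k" "m + k" "Suc (m + k)"] by simp
      also have "\<dots> \<le> (2 * c / 2^m - 2 * c / 2^(m+k)) + c / 2^(m+k)"
        using Suc f(4) by (intro add_mono)
      also have "\<dots> = 2 * c / 2^m - 2 * c / 2^(m + Suc k)"
        by (simp add: field_simps)
      finally show ?case .
    qed
    have c0: "c \<ge> 0" using L p by (simp add: c_def)
    have step': "N (f m - f n) \<le> 2 * c / 2^m" if "m \<le> n" for m n
    proof -
      have "2 * c / 2 ^ (m + (n - m)) \<ge> 0" using c0 by simp
      then show ?thesis using step[of m "n - m"] that by simp
    qed
    have geo: "(\<lambda>k. b / 2^k) \<longlonglongrightarrow> 0" for b :: real
      using LIMSEQ_divide_realpow_zero[of 2 b] by simp
    have "\<exists>m. \<forall>i\<ge>m. \<forall>j\<ge>m. N (f i - f j) < e" if e: "e > 0" for e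
    proof -
      have "eventually (\<lambda>k. 2 * c / 2^k < e) sequentially"
        using order_tendstoD(2)[OF geo e] .
      then obtain m where m: "\<And>k. k \<ge> m \<Longrightarrow> 2 * c / 2^k < e"
        by (auto simp: eventually_sequentially)
      have "N (f i - f j) < e" if "i \<ge> m" "j \<ge> m" for i j
        using step'[of i j] step'[of j i] m[OF that(1)] m[OF that(2)]
          norm_on_commute[OF D N f(1) f(1), of i j] by (cases "i \<le> j") auto
      then show ?thesis by blast
    qed
    then obtain s where s: "s \<in> D" "(\<lambda>n. N (f n - s)) \<longlonglongrightarrow> 0"
      using cN[unfolded banach_on_iff[OF D N]] f(1) by blast
    \<comment> \<open>By \<open>le\<close>, convergence in \<open>N\<close> implies convergence in
      \<open>M\<close>, and the remainders tend to zero in \<open>M\<close>.\<close>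
    have s0: "s = 0"
    proof -
      have "M s \<le> 0"
      proof (rule LIMSEQ_le_const)
        show "(\<lambda>n. C * N (f n - s) + M x / 2^n) \<longlonglongrightarrow> 0"
          using tendsto_add[OF tendsto_mult_right_zero[OF s(2), of C] geo[of "M x"]] by simp
        have "M s \<le> C * N (f n - s) + M x / 2^n" for n
        proof -
          have "M s \<le> M (s - f n) + M (f n)"
            using norm_onD(5)[OF M csub_diff[OF D s(1) f(1)] f(1), of n n] by simp
          also have "M (s - f n) = M (f n - s)"
            by (rule norm_on_commute[OF D M s(1) f(1)])
          finally show ?thesis
            using le[OF csub_diff[OF D f(1) s(1)], of n] f(2)[of n] by linarith
        qed
        then show "\<exists>k. \<forall>n\<ge>k. M s \<le> C * N (f n - s) + M x / 2^n" by blast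
      qed
      then show ?thesis using norm_onD(1,2)[OF M s(1)] by simp
    qed
    have "N x \<le> 2 * c"
    proof (rule LIMSEQ_le_const)
      show "(\<lambda>n. 2 * c + N (f n - s)) \<longlonglongrightarrow> 2 * c"
        using tendsto_add[OF tendsto_const s(2), of "2 * c"] by simp
      have "N x \<le> 2 * c + N (f n - s)" for n
        using norm_onD(5)[OF N csub_diff[OF D x f(1)] f(1), of n n] step'[of 0 n] f(3) s0 by simp
      then show "\<exists>k. \<forall>n\<ge>k. N x \<le> 2 * c + N (f n - s)" by blast
    qed
    then show ?thesis by (simp add: c_def)
  qed
  then show ?thesis by blast
qed

section \<open>Orthogonality and the Riesz representation\<close>

lemma cinner_add_right: "cinner x (y + z) = cinner x y + cinner x (z :: 'a::complex_hilbert)"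
  by (simp add: cinner_commute[of x] cinner_add_left)

lemma cinner_scaleC_right: "cinner x (c *\<^sub>C y) = cnj c * cinner x (y :: 'a::complex_hilbert)"
  by (simp add: cinner_commute[of x] cinner_scaleC_left)

lemma cinner_zero [simp]: "cinner 0 x = 0" "cinner x 0 = (0 :: complex)" for x :: "'a::complex_hilbert"
  using cinner_scaleC_left[of 0 0 x] cinner_scaleC_right[of x 0 0] by simp_all

lemma cinner_minus_left: "cinner (- x) y = - cinner x y" for x :: "'a::complex_hilbert"
  using cinner_add_left[of "-x" x y] by (simp add: add_eq_0_iff)

lemma cinner_diff_left: "cinner (x - y) z = cinner x z - cinner y z" for x :: "'a::complex_hilbert"
  using cinner_add_left[of x "-y" z] by (simp add: cinner_minus_left)

lemma cinner_diff_right: "cinner x (y - z) = cinner x y - cinner x z" for x :: "'a::complex_hilbert"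
  by (simp add: cinner_commute[of x] cinner_diff_left)

lemma norm_squared: "(norm x)\<^sup>2 = Re (cinner x x)" for x :: "'a::complex_hilbert"
  by (simp add: norm_eq_sqrt_cinner cinner_nonneg)

lemma cinner_self: "cinner x x = of_real ((norm x)\<^sup>2)" for x :: "'a::complex_hilbert"
  using cinner_commute[of x x] by (simp add: complex_eq_iff norm_squared)

lemma Re_cinner_commute: "Re (cinner y x) = Re (cinner x y)" for x :: "'a::complex_hilbert"
  using arg_cong[OF cinner_commute[of x y], of Re] by simp

lemma norm_diff_squared: "(norm (x - y))\<^sup>2 = (norm x)\<^sup>2 + (norm y)\<^sup>2 - 2 * Re (cinner x y)"
  for x :: "'a::complex_hilbert"
  by (simp add: norm_squared cinner_diff_left cinner_diff_right Re_cinner_commute[of y x])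

lemma norm_add_squared: "(norm (x + y))\<^sup>2 = (norm x)\<^sup>2 + (norm y)\<^sup>2 + 2 * Re (cinner x y)"
  for x :: "'a::complex_hilbert"
  by (simp add: norm_squared cinner_add_left cinner_add_right Re_cinner_commute[of y x])

lemma norm_scaleC: "norm (c *\<^sub>C x) = cmod c * norm x" for x :: "'a::complex_hilbert"
proof -
  have "(norm (c *\<^sub>C x))\<^sup>2 = Re (c * cnj c * cinner x x)"
    by (simp add: norm_squared cinner_scaleC_left cinner_scaleC_right algebra_simps)
  also have "\<dots> = (cmod c * norm x)\<^sup>2"
    by (simp add: cinner_self complex_norm_square[symmetric] power_mult_distrib
        flip: of_real_power of_real_mult)
  finally show ?thesis by (simp add: power2_eq_iff_nonneg)
qed

text \<open>Pythagoras for the component of \<open>x\<close> along \<open>y\<close>. Nonnegativity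
  of the left side yields Cauchy-Schwarz; for a vector of minimal norm the drop must vanish, which
  yields orthogonality.\<close>

lemma norm_diff_projection:
  fixes x y :: "'a::complex_hilbert"
  assumes "y \<noteq> 0"
  shows "(norm (x - (cinner x y / of_real ((norm y)\<^sup>2)) *\<^sub>C y))\<^sup>2 = (norm x)\<^sup>2 - (cmod (cinner x y))\<^sup>2 / (norm y)\<^sup>2"
proof -
  define c where "c = cinner x y / of_real ((norm y)\<^sup>2)"
  have "Re (cinner x (c *\<^sub>C y)) = (cmod (cinner x y))\<^sup>2 / (norm y)\<^sup>2"
    by (simp add: c_def cinner_scaleC_right complex_norm_square[symmetric] mult.commute
        flip: of_real_power of_real_mult of_real_divide)
  moreover have "cmod c = cmod (cinner x y) / (norm y)\<^sup>2"
    unfolding c_def norm_divide norm_of_real by simp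
  then have "norm (c *\<^sub>C y) = cmod (cinner x y) / norm y"
    using assms by (simp add: norm_scaleC power2_eq_square)
  then have "(norm (c *\<^sub>C y))\<^sup>2 = (cmod (cinner x y))\<^sup>2 / (norm y)\<^sup>2"
    by (simp add: power_divide)
  ultimately show ?thesis
    unfolding c_def[symmetric] by (simp add: norm_diff_squared)
qed

lemma cinner_Cauchy_Schwarz: "cmod (cinner x y) \<le> norm x * norm y" for x :: "'a::complex_hilbert"
proof (cases "y = 0")
  case False
  then have "(cmod (cinner x y))\<^sup>2 / (norm y)\<^sup>2 \<le> (norm x)\<^sup>2"
    by (metis norm_diff_projection diff_ge_0_iff_ge zero_le_power2)
  then have "(cmod (cinner x y))\<^sup>2 \<le> (norm x * norm y)\<^sup>2"
    using False by (simp add: divide_le_eq power_mult_distrib)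
  then show ?thesis by (rule power2_le_imp_le) simp
qed simp

text \<open>The midpoint form of the parallelogram law: in a convex set the subtracted term is again
  the norm of a member.\<close>

lemma parallelogram: "(norm (x - y))\<^sup>2 = 2 * (norm x)\<^sup>2 + 2 * (norm y)\<^sup>2 - 4 * (norm ((1/2) *\<^sub>R (x + y)))\<^sup>2"
  for x :: "'a::complex_hilbert"
proof -
  have "4 * (norm ((1/2) *\<^sub>R (x + y)))\<^sup>2 = (norm (x + y))\<^sup>2"
    by (simp add: power_mult_distrib power_divide)
  then show ?thesis using norm_diff_squared[of x y] norm_add_squared[of x y] by simp
qed

section \<open>Minimal norm, orthogonal vectors and their consequences\<close>

text \<open>A minimizing sequence is Cauchy, because the midpoints stay in \<open>C\<close> and the
  parallelogram law bounds distances by the excess over the infimum.\<close>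

lemma exists_minimal_norm:
  fixes C :: "'a::complex_hilbert set"
  assumes cl: "closed C" and cv: "convex C" and ne: "C \<noteq> {}"
  shows "\<exists>x\<in>C. \<forall>y\<in>C. norm x \<le> norm y"
proof -
  define d where "d = (INF x\<in>C. (norm x)\<^sup>2)"
  have bb: "bdd_below ((\<lambda>x. (norm x)\<^sup>2) ` C)" by (rule bdd_belowI[of _ 0]) auto
  have dle: "d \<le> (norm x)\<^sup>2" if "x \<in> C" for x
    unfolding d_def using bb that by (rule cINF_lower)
  have "\<exists>x\<in>C. (norm x)\<^sup>2 < d + 1 / Suc n" for n
    using cINF_less_iff[OF ne bb, of "d + 1 / Suc n"] by (simp add: d_def)
  then obtain f where f: "\<And>n. f n \<in> C" "\<And>n. (norm (f n))\<^sup>2 < d + 1 / Suc n"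
    by metis
  \<comment> \<open>Both squared norms exceed \<open>d\<close> by at most \<open>1 / Suc k\<close>
    and that of the midpoint is at least \<open>d\<close>, so the terms in \<open>d\<close>
    cancel.\<close>
  have key: "(norm (f i - f j))\<^sup>2 \<le> 4 / Suc k" if "k \<le> i" "k \<le> j" for i j k
  proof -
    have "(1/2) *\<^sub>R (f i + f j) \<in> C"
      using cv f(1)[of i] f(1)[of j] convexD[of C "f i" "f j" "1/2" "1/2"] by (simp add: scaleR_add_right)
    then have "d \<le> (norm ((1/2) *\<^sub>R (f i + f j)))\<^sup>2" by (rule dle)
    moreover have "1 / Suc i \<le> 1 / real (Suc k)" "1 / Suc j \<le> 1 / real (Suc k)"
      using that by (auto simp: field_simps)
    ultimately show ?thesis
      using parallelogram[of "f i" "f j"] f(2)[of i] f(2)[of j] by simp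
  qed
  have "Cauchy f"
  proof (rule metric_CauchyI)
    fix e :: real assume e: "e > 0"
    obtain k :: nat where "4 / e\<^sup>2 < real k"
      using reals_Archimedean2 by blast
    then have "4 / e\<^sup>2 < real (Suc k)" by simp
    then have k: "4 / real (Suc k) < e\<^sup>2"
      using e by (simp only: divide_less_eq zero_less_power of_nat_0_less_iff zero_less_Suc if_True mult.commute)
    have "dist (f i) (f j) < e" if "k \<le> i" "k \<le> j" for i j
    proof -
      have "(norm (f i - f j))\<^sup>2 < e\<^sup>2"
        using key[OF that] k by (rule le_less_trans)
      then show ?thesis using e by (simp add: dist_norm power2_less_imp_less)
    qed
    then show "\<exists>M. \<forall>m\<ge>M. \<forall>n\<ge>M. dist (f m) (f n) < e" by blast
  qed
  then obtain x where x: "f \<longlonglongrightarrow> x" using Cauchy_convergent_iff convergent_def by blast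
  have xC: "x \<in> C" using cl f(1) x closed_sequentially by blast
  have "(norm x)\<^sup>2 \<le> d"
  proof (rule LIMSEQ_le)
    show "(\<lambda>n. (norm (f n))\<^sup>2) \<longlonglongrightarrow> (norm x)\<^sup>2" by (intro tendsto_intros x)
    show "(\<lambda>n. d + 1 / real (Suc n)) \<longlonglongrightarrow> d"
      using tendsto_add[OF tendsto_const LIMSEQ_inverse_real_of_nat, of d] by (simp add: inverse_eq_divide)
    show "\<exists>N. \<forall>n\<ge>N. (norm (f n))\<^sup>2 \<le> d + 1 / real (Suc n)" using f(2) less_imp_le by blast
  qed
  have "norm x \<le> norm y" if "y \<in> C" for y
    using order_trans[OF \<open>(norm x)\<^sup>2 \<le> d\<close> dle[OF that]] by (rule power2_le_imp_le) simp
  then show ?thesis using xC by blast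
qed

text \<open>The vector of minimal norm in a coset \<open>a + S\<close> with \<open>a\<close> outside
  \<open>S\<close> is nonzero, and no shift along an element of \<open>S\<close> can shorten
  it.\<close>

lemma exists_orthogonal:
  fixes S :: "'a::complex_hilbert set"
  assumes S: "complex_vector.subspace S" and cl: "closed S" and ne: "S \<noteq> UNIV"
  shows "\<exists>v. v \<noteq> 0 \<and> (\<forall>x\<in>S. cinner x v = 0)"
proof -
  obtain a where a: "a \<notin> S" using ne by blast
  let ?C = "(\<lambda>x. a + x) ` S"
  have "convex S"
    unfolding convex_def
    by (auto simp: scaleR_scaleC intro!: complex_vector.subspace_add[OF S] complex_vector.subspace_scale[OF S])
  then have "convex ?C" by (rule convex_translation)
  moreover have "closed ?C" using cl by (rule closed_translation)
  ultimately obtain v where v: "v \<in> ?C" "\<And>y. y \<in> ?C \<Longrightarrow> norm v \<le> norm y"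
    using exists_minimal_norm[of ?C] complex_vector.subspace_0[OF S] by blast
  then obtain s where s: "s \<in> S" "v = a + s" by blast
  have "v \<noteq> 0"
    using complex_vector.subspace_neg[OF S s(1)] a s(2) by (metis eq_neg_iff_add_eq_0)
  moreover have "cinner x v = 0" if x: "x \<in> S" for x
  proof (cases "x = 0")
    case False
    define c where "c = cinner v x / of_real ((norm x)\<^sup>2)"
    have "v - c *\<^sub>C x = a + (s - c *\<^sub>C x)" using s by simp
    then have "v - c *\<^sub>C x \<in> ?C"
      using complex_vector.subspace_diff[OF S s(1) complex_vector.subspace_scale[OF S x]] by blast
    then have "(norm v)\<^sup>2 \<le> (norm (v - c *\<^sub>C x))\<^sup>2" using v(2) by simp
    then have "(cmod (cinner v x))\<^sup>2 / (norm x)\<^sup>2 \<le> 0"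
      using norm_diff_projection[OF False, of v] unfolding c_def[symmetric] by simp
    then have "cinner v x = 0" using False by (simp add: divide_le_0_iff)
    then show ?thesis using cinner_commute[of x v] by simp
  qed simp
  ultimately show ?thesis by blast
qed

text \<open>The kernel is closed, so some nonzero \<open>v\<close> is orthogonal to it. Every
  \<open>x\<close> differs from a multiple of \<open>v\<close> by an element of the kernel.\<close>

lemma Riesz_representation:
  fixes f :: "'a::complex_hilbert \<Rightarrow> complex"
  assumes add: "\<And>x y. f (x + y) = f x + f y" and scale: "\<And>c x. f (c *\<^sub>C x) = c * f x"
    and bd: "\<And>x. cmod (f x) \<le> K * norm x"
  shows "\<exists>z. \<forall>x. f x = cinner x z"
proof (cases "\<forall>x. f x = 0")
  case True
  then show ?thesis by (intro exI[of _ 0]) simp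
next
  case False
  let ?S = "{x. f x = 0}"
  have f0: "f 0 = 0" using scale[of 0 0] by simp
  have fdiff: "f (x - y) = f x - f y" for x y
    using add[of "x - y" y] by simp
  have "bounded_linear f"
    by (rule bounded_linear_intro[of f K])
      (auto simp: add scale scaleR_scaleC bd mult.commute[of _ K] scaleR_conv_of_real)
  then have "closed ?S"
    by (intro closed_Collect_eq continuous_intros linear_continuous_on) 
  moreover have "complex_vector.subspace ?S"
    by (auto simp: complex_vector.subspace_def f0 add scale)
  ultimately obtain v where v: "v \<noteq> 0" "\<And>x. f x = 0 \<Longrightarrow> cinner x v = 0"
    using exists_orthogonal[of ?S] False by blast
  have fv: "f v \<noteq> 0" using v cinner_eq_zero_iff by blast
  \<comment> \<open>The scalar is forced by taking \<open>x = v\<close>.\<close>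
  have "f x = cinner x ((cnj (f v) / of_real ((norm v)\<^sup>2)) *\<^sub>C v)" for x
  proof -
    have "f (x - (f x / f v) *\<^sub>C v) = 0" using fv by (simp add: fdiff scale)
    from v(2)[OF this] have "cinner x v = f x / f v * of_real ((norm v)\<^sup>2)"
      by (simp add: cinner_diff_left cinner_scaleC_left cinner_self)
    then show ?thesis using v(1) fv by (simp add: cinner_scaleC_right)
  qed
  then show ?thesis by blast
qed

text \<open>The closure is again a subspace; were it proper, \<open>exists_orthogonal\<close> would
  give a nonzero vector orthogonal to \<open>S\<close>.\<close>

lemma dense_subspace_orthogonalI:
  fixes S :: "'a::complex_hilbert set"
  assumes S: "complex_vector.subspace S" and orth: "\<And>v. (\<And>x. x \<in> S \<Longrightarrow> cinner x v = 0) \<Longrightarrow> v = 0"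
  shows "dense_subspace S"
proof -
  have lin: "bounded_linear (\<lambda>x. c *\<^sub>C x)" for c :: complex
    by (rule bounded_linear_intro[of _ "cmod c"])
      (auto simp: scaleC_add_right scaleR_scaleC scaleC_scaleC norm_scaleC mult.commute)
  have "complex_vector.subspace (closure S)"
    unfolding complex_vector.subspace_def
  proof (intro conjI ballI allI)
    show "0 \<in> closure S" using complex_vector.subspace_0[OF S] closure_subset by blast
    show "c *\<^sub>C x \<in> closure S" if x: "x \<in> closure S" for c x
    proof -
      obtain f where f: "\<And>n. f n \<in> S" "f \<longlonglongrightarrow> x" using x closure_sequential by metis
      have "(\<lambda>n. c *\<^sub>C f n) \<longlonglongrightarrow> c *\<^sub>C x" by (rule bounded_linear.tendsto[OF lin f(2)])
      then show ?thesis using f(1) complex_vector.subspace_scale[OF S] closure_sequential by metis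
    qed
    show "x + y \<in> closure S" if x: "x \<in> closure S" "y \<in> closure S" for x y
    proof -
      obtain f g where f: "\<And>n. f n \<in> S" "f \<longlonglongrightarrow> x" "\<And>n. g n \<in> S" "g \<longlonglongrightarrow> y"
        using x closure_sequential by metis
      have "(\<lambda>n. f n + g n) \<longlonglongrightarrow> x + y" by (intro tendsto_add f)
      moreover have "\<forall>n. f n + g n \<in> S" using f complex_vector.subspace_add[OF S] by blast
      ultimately show ?thesis unfolding closure_sequential by (intro exI[of _ "\<lambda>n. f n + g n"]) simp
    qed
  qed
  have "closure S = UNIV"
  proof (rule ccontr)
    assume "closure S \<noteq> UNIV"
    then obtain v where "v \<noteq> 0" "\<forall>x\<in>closure S. cinner x v = 0"
      using exists_orthogonal[OF \<open>complex_vector.subspace (closure S)\<close> closed_closure] by blast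
    with orth closure_subset[of S] show False by blast
  qed
  with S show ?thesis by simp
qed

text \<open>Approximating \<open>z - w\<close> from \<open>D\<close> shows that it is orthogonal to
  itself.\<close>

lemma dense_cinner_eq:
  assumes D: "closure D = UNIV" and eq: "\<And>y. y \<in> D \<Longrightarrow> cinner z y = cinner w (y :: 'a::complex_hilbert)"
  shows "z = w"
proof -
  obtain f where f: "\<And>n. f n \<in> D" "f \<longlonglongrightarrow> z - w"
    using D closure_sequential by (metis UNIV_I)
  have "bounded_linear (\<lambda>x. cinner x (z - w))"
    by (rule bounded_linear_intro[of _ "norm (z - w)"])
      (auto simp: cinner_add_left scaleR_scaleC cinner_scaleC_left cinner_Cauchy_Schwarz scaleR_conv_of_real)
  from bounded_linear.tendsto[OF this f(2)]
  have "(\<lambda>n. cinner (f n) (z - w)) \<longlonglongrightarrow> cinner (z - w) (z - w)" .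
  moreover have "cinner (f n) (z - w) = 0" for n
    using eq[OF f(1)[of n]] cinner_commute[of "f n" "z - w"] by (simp add: cinner_diff_left)
  ultimately have "cinner (z - w) (z - w) = 0"
    by (simp add: LIMSEQ_const_iff)
  then show ?thesis by (simp add: cinner_eq_zero_iff)
qed

section \<open>Dual norms, form operators and adjoints\<close>

text \<open>Rescale \<open>x\<close> to \<open>N\<close>-norm 1; \<open>le\<close> makes the
  supremum finite. Homogeneity is stated for absolute values so that conjugate linear functionals
  such as \<open>\<Phi> x\<close> are covered.\<close>

lemma dual_norm_on_bound:
  assumes N: "norm_on D N" and D: "complex_vector.subspace D"
    and scale: "\<And>c x. x \<in> D \<Longrightarrow> cmod (f (c *\<^sub>C x)) = cmod c * cmod (f x)"
    and le: "\<And>x. x \<in> D \<Longrightarrow> cmod (f x) \<le> K * N x" and x: "x \<in> D"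
  shows "cmod (f x) \<le> dual_norm_on D N f * N x"
proof (cases "x = 0")
  case True
  then show ?thesis using le[OF x] norm_onD(2)[OF N x] by simp
next
  case False
  then have p: "N x > 0" using norm_onD(1,2)[OF N x] by fastforce
  define u where "u = complex_of_real (1 / N x) *\<^sub>C x"
  have u: "u \<in> D" "N u = 1"
    using csub_scale[OF D x] norm_onD(3)[OF N x] p by (simp_all add: u_def norm_divide)
  have "cmod (f y) \<le> \<bar>K\<bar>" if "y \<in> D" "N y \<le> 1" for y
    using le[OF that(1)] norm_onD(1)[OF N that(1)] that(2) mult_mono[of K "\<bar>K\<bar>" "N y" 1]
    by linarith
  then have "bdd_above ((\<lambda>x. cmod (f x)) ` {x \<in> D. N x \<le> 1})"
    by (auto intro!: bdd_aboveI[of _ "\<bar>K\<bar>"])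
  then have "cmod (f u) \<le> dual_norm_on D N f"
    unfolding dual_norm_on_def using u by (intro cSUP_upper) auto
  moreover have "cmod (f u) = cmod (f x) / N x"
    using scale[OF x] p by (simp add: u_def norm_divide)
  ultimately show ?thesis using p by (simp add: divide_le_eq)
qed

lemma dual_norm_on_le:
  assumes N: "norm_on D N" and D: "complex_vector.subspace D"
    and le: "\<And>x. x \<in> D \<Longrightarrow> cmod (f x) \<le> K * N x" and K: "0 \<le> K"
  shows "dual_norm_on D N f \<le> K"
  unfolding dual_norm_on_def
proof (rule cSUP_least)
  show "{x \<in> D. N x \<le> 1} \<noteq> {}"
    using csub_0[OF D] norm_onD(2)[OF N csub_0[OF D]] by (auto intro!: exI[of _ 0])
  show "cmod (f x) \<le> K" if "x \<in> {x \<in> D. N x \<le> 1}" for x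
    using le[of x] that K mult_left_mono[of "N x" 1 K] by force
qed

lemma dual_norm_on_nonneg:
  assumes N: "norm_on D N" and D: "complex_vector.subspace D"
    and scale: "\<And>c x. x \<in> D \<Longrightarrow> cmod (f (c *\<^sub>C x)) = cmod c * cmod (f x)"
    and le: "\<And>x. x \<in> D \<Longrightarrow> cmod (f x) \<le> K * N x"
  shows "0 \<le> dual_norm_on D N f"
proof (cases "\<exists>x\<in>D. f x \<noteq> 0")
  case True
  then obtain x where x: "x \<in> D" "f x \<noteq> 0" by blast
  have "0 < cmod (f x)" using x by simp
  also have "\<dots> \<le> dual_norm_on D N f * N x"
    using dual_norm_on_bound[OF N D scale le x(1)] .
  finally show ?thesis
    using norm_onD(1)[OF N x(1)] by (simp add: zero_less_mult_iff)
next
  case False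
  have "dual_norm_on D N f = (SUP x\<in>{x \<in> D. N x \<le> 1}. 0)"
    unfolding dual_norm_on_def using False by (intro SUP_cong) auto
  moreover have "{x \<in> D. N x \<le> 1} \<noteq> {}"
    using csub_0[OF D] norm_onD(2)[OF N csub_0[OF D]] by (auto intro!: exI[of _ 0])
  ultimately show ?thesis by simp
qed

section \<open>Rules for forms, their operators and adjoints\<close>

lemma sesquilinear_onD:
  assumes "sesquilinear_on D W" "x \<in> D" "y \<in> D"
  shows "z \<in> D \<Longrightarrow> W (x + z) y = W x y + W z y" "W (c *\<^sub>C x) y = c * W x y"
    "z \<in> D \<Longrightarrow> W x (y + z) = W x y + W x z" "W x (c *\<^sub>C y) = cnj c * W x y"
  using assms by (simp_all add: sesquilinear_on_def)

lemma sesquilinear_on_diff: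
  assumes W: "sesquilinear_on D W" and D: "complex_vector.subspace D"
    and x: "x \<in> D" "y \<in> D" "z \<in> D"
  shows "W (x - z) y = W x y - W z y" "W x (y - z) = W x y - W x z"
proof -
  show "W (x - z) y = W x y - W z y"
    using sesquilinear_onD(1)[OF W csub_diff[OF D x(1,3)] x(2,3)] by simp
  show "W x (y - z) = W x y - W x z"
    using sesquilinear_onD(3)[OF W x(1) csub_diff[OF D x(2,3)] x(3)] by simp
qed

lemma form_op_eqI:
  assumes "closure D = UNIV" "\<And>y. y \<in> D \<Longrightarrow> W x y = cinner z y"
  shows "form_op D W x = z"
  unfolding form_op_def
proof (rule the_equality)
  show "\<forall>y\<in>D. W x y = cinner z y" using assms(2) by blast
  show "w = z" if "\<forall>y\<in>D. W x y = cinner w y" for w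
    using that assms(2) by (intro dense_cinner_eq[OF assms(1)]) simp
qed

lemma form_op_eq:
  assumes "closure D = UNIV" "x \<in> form_dom D W" "y \<in> D"
  shows "W x y = cinner (form_op D W x) y"
proof -
  obtain z where "\<And>y. y \<in> D \<Longrightarrow> W x y = cinner z y"
    using assms(2) by (auto simp: form_dom_def)
  then show ?thesis using form_op_eqI[OF assms(1)] assms(3) by metis
qed

lemma form_dom_subset: "form_dom D W \<subseteq> D"
  by (auto simp: form_dom_def)

lemma adjoint_op_eqI:
  assumes "closure S = UNIV" "\<And>x. x \<in> S \<Longrightarrow> cinner (T x) y = cinner x z"
  shows "adjoint_op S T y = z"
  unfolding adjoint_op_def
proof (rule the_equality)
  show "\<forall>x\<in>S. cinner (T x) y = cinner x z" using assms(2) by blast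
  fix w assume w: "\<forall>x\<in>S. cinner (T x) y = cinner x w"
  show "w = z"
  proof (rule dense_cinner_eq[OF assms(1)])
    fix x assume "x \<in> S"
    then have "cinner x w = cinner x z" using w assms(2) by simp
    then show "cinner w x = cinner z x"
      using cinner_commute[of w x] cinner_commute[of z x] by simp
  qed
qed

lemma adjoint_op_eq:
  assumes "closure S = UNIV" "y \<in> adjoint_dom S T" "x \<in> S"
  shows "cinner (T x) y = cinner x (adjoint_op S T y)"
proof -
  obtain z where "\<And>x. x \<in> S \<Longrightarrow> cinner (T x) y = cinner x z"
    using assms(2) by (auto simp: adjoint_dom_def)
  then show ?thesis using adjoint_op_eqI[OF assms(1)] assms(3) by metis
qed

section \<open>Perturbed solvable forms\<close>

locale perturbed_form =
  fixes D :: "'a::complex_hilbert set" and N :: "'a \<Rightarrow> real" and W Y :: "'a \<Rightarrow> 'a \<Rightarrow> complex"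
  assumes dense: "dense_subspace D"
    and W: "sesquilinear_on D W"
    and N: "norm_on D N"
    and q_closed: "q_closed D W N"
    and Y: "Y \<in> perturbations D W N"
begin

definition \<Phi> :: "'a \<Rightarrow> 'a \<Rightarrow> complex" where "\<Phi> x y = W x y + Y x y"

text \<open>Pulling the norm of the conjugate dual back along \<open>x \<mapsto> \<Phi> x\<close> turns the bounded inverse theorem
  into a comparison of two complete norms on \<open>D\<close>.\<close>

definition M :: "'a \<Rightarrow> real" where "M x = dual_norm_on D N (\<Phi> x)"

section \<open>Boundedness and nondegeneracy of the perturbed form\<close>

lemma D: "complex_vector.subspace D" and closure_D: "closure D = UNIV"
  using dense by simp_all

lemma Y_sesquilinear: "sesquilinear_on UNIV Y"
  using Y by (simp add: perturbations_def bounded_sesquilinear_def)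

lemma Y_bounded: "\<exists>K\<ge>0. \<forall>x y. cmod (Y x y) \<le> K * norm x * norm y"
proof -
  obtain K where K: "\<And>x y. cmod (Y x y) \<le> K * norm x * norm y"
    using Y by (auto simp: perturbations_def bounded_sesquilinear_def)
  have "K * norm x * norm y \<le> \<bar>K\<bar> * norm x * norm y" for x y :: 'a
    by (intro mult_right_mono) auto
  then show ?thesis using order_trans[OF K] by (intro exI[of _ "\<bar>K\<bar>"]) auto
qed

lemma norm_le: "\<exists>\<alpha>>0. \<forall>x\<in>D. norm x \<le> \<alpha> * N x"
  using q_closed by (simp add: q_closed_def)

lemma sesquilinear: "sesquilinear_on D \<Phi>"
  using W Y_sesquilinear by (simp add: sesquilinear_on_def \<Phi>_def algebra_simps)

lemmas diff_left = sesquilinear_on_diff(1)[OF sesquilinear D]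
lemmas diff_right = sesquilinear_on_diff(2)[OF sesquilinear D]

text \<open>The ambient norm is at most \<open>a * N\<close>, so \<open>Y\<close> adds
  \<open>K * a * a\<close> to the bound \<open>b\<close> of \<open>W\<close>.\<close>

lemma bounded: "\<exists>b\<ge>0. \<forall>x\<in>D. \<forall>y\<in>D. cmod (\<Phi> x y) \<le> b * N x * N y"
proof -
  obtain b where b: "b > 0" "\<And>x y. x \<in> D \<Longrightarrow> y \<in> D \<Longrightarrow> cmod (W x y) \<le> b * N x * N y"
    using q_closed by (auto simp: q_closed_def)
  obtain K where K: "K \<ge> 0" "\<And>x y. cmod (Y x y) \<le> K * norm x * norm y"
    using Y_bounded by blast
  obtain a where a: "a > 0" "\<And>x. x \<in> D \<Longrightarrow> norm x \<le> a * N x"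
    using norm_le by blast
  have "cmod (\<Phi> x y) \<le> (b + K * a * a) * N x * N y" if xy: "x \<in> D" "y \<in> D" for x y
  proof -
    have "norm x * norm y \<le> (a * N x) * (a * N y)"
      using a xy norm_onD(1)[OF N] by (intro mult_mono) auto
    then have "K * (norm x * norm y) \<le> K * ((a * N x) * (a * N y))"
      using K(1) by (rule mult_left_mono)
    then have "cmod (Y x y) \<le> K * a * a * N x * N y"
      using K(2)[of x y] by (simp add: mult_ac)
    then show ?thesis
      using b(2)[OF xy] norm_triangle_ineq[of "W x y" "Y x y"]
      by (simp add: \<Phi>_def distrib_right)
  qed
  moreover have "b + K * a * a \<ge> 0" using b K a by simp
  ultimately show ?thesis by blast
qed

text \<open>Linearity in the first argument reduces this to the trivial kernel required in
  \<open>perturbations\<close>.\<close>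

lemma \<Phi>_eq_imp_eq:
  assumes "x \<in> D" "x' \<in> D" "\<And>y. y \<in> D \<Longrightarrow> \<Phi> x y = \<Phi> x' y"
  shows "x = x'"
proof -
  have "\<forall>y\<in>D. W (x - x') y + Y (x - x') y = 0"
    using assms diff_left by (simp add: \<Phi>_def)
  then have "x - x' = 0"
    using Y csub_diff[OF D assms(1,2)] unfolding perturbations_def by blast
  then show ?thesis by simp
qed

lemma \<Phi>_represents: "f \<in> conj_dual_on D N \<Longrightarrow> \<exists>x\<in>D. \<forall>y\<in>D. f y = \<Phi> x y"
  using Y by (simp add: perturbations_def \<Phi>_def)

lemma cmod_\<Phi>_scale: "x \<in> D \<Longrightarrow> y \<in> D \<Longrightarrow> cmod (\<Phi> x (c *\<^sub>C y)) = cmod c * cmod (\<Phi> x y)"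
  by (simp add: sesquilinear_onD(4)[OF sesquilinear] norm_mult)

section \<open>The pulled back norm and its equivalence with \<open>N\<close>\<close>

lemma \<Phi>_le_M:
  assumes "x \<in> D" "y \<in> D"
  shows "cmod (\<Phi> x y) \<le> M x * N y"
  unfolding M_def using bounded assms
  by (metis (no_types, lifting) dual_norm_on_bound[OF N D] cmod_\<Phi>_scale)

lemma M_nonneg: "x \<in> D \<Longrightarrow> 0 \<le> M x"
  unfolding M_def using bounded
  by (metis (no_types, lifting) dual_norm_on_nonneg[OF N D] cmod_\<Phi>_scale)

lemma M_leI: "(\<And>y. y \<in> D \<Longrightarrow> cmod (\<Phi> x y) \<le> K * N y) \<Longrightarrow> 0 \<le> K \<Longrightarrow> M x \<le> K"
  unfolding M_def by (rule dual_norm_on_le[OF N D])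

lemma M_norm: "norm_on D M"
  unfolding norm_on_def
proof (intro conjI ballI allI)
  show "0 \<le> M x" if "x \<in> D" for x using that by (rule M_nonneg)
  have zero: "\<Phi> 0 y = 0" if "y \<in> D" for y
    using sesquilinear_onD(2)[OF sesquilinear that that, of 0] by simp
  show eq0: "M x = 0 \<longleftrightarrow> x = 0" if x: "x \<in> D" for x
  proof
    assume "M x = 0"
    then have "\<Phi> x y = 0" if "y \<in> D" for y using \<Phi>_le_M[OF x that] by simp
    then show "x = 0" using \<Phi>_eq_imp_eq[OF x csub_0[OF D]] zero by simp
  next
    assume "x = 0"
    then have "M x \<le> 0" using zero by (intro M_leI) auto
    then show "M x = 0" using M_nonneg[OF x] by simp
  qed
  have le: "M (c *\<^sub>C x) \<le> cmod c * M x" if "x \<in> D" for c x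
    using that \<Phi>_le_M[OF that] M_nonneg[OF that]
    by (intro M_leI) (auto simp: sesquilinear_onD(2)[OF sesquilinear] norm_mult mult.assoc mult_left_mono)
  show "M (c *\<^sub>C x) = cmod c * M x" if x: "x \<in> D" for c x
  proof (cases "c = 0")
    case True
    then show ?thesis using eq0[OF csub_0[OF D]] by simp
  next
    case False
    \<comment> \<open>Applying \<open>le\<close> to the scalar \<open>inverse c\<close> and the
      vector \<open>c *\<^sub>C x\<close> reverses the inequality.\<close>
    have "M x \<le> cmod (inverse c) * M (c *\<^sub>C x)"
      using le[OF csub_scale[OF D x, of c], of "inverse c"] False by (simp add: scaleC_scaleC scaleC_one)
    then show ?thesis using le[OF x, of c] False by (simp add: norm_divide norm_inverse field_simps)
  qed
  show "M (x + y) \<le> M x + M y" if xy: "x \<in> D" "y \<in> D" for x y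
  proof (rule M_leI)
    fix z assume z: "z \<in> D"
    show "cmod (\<Phi> (x + y) z) \<le> (M x + M y) * N z"
      using \<Phi>_le_M[OF xy(1) z] \<Phi>_le_M[OF xy(2) z] norm_triangle_ineq[of "\<Phi> x z" "\<Phi> y z"]
        sesquilinear_onD(1)[OF sesquilinear xy(1) z xy(2)] by (simp add: distrib_right)
  qed (use M_nonneg xy in simp)
qed

text \<open>Dual spaces are complete: the functionals \<open>\<Phi> (X n)\<close> converge pointwise
  to a bounded conjugate linear functional, and by the choice of \<open>Y\<close> this limit is
  again of the form \<open>\<Phi> x\<close>.\<close>

lemma M_complete: "banach_on D M"
  unfolding banach_on_iff[OF D M_norm]
proof (intro allI impI)
  fix X :: "nat \<Rightarrow> 'a" assume X: "\<forall>n. X n \<in> D" and Cau: "\<forall>e>0. \<exists>m. \<forall>i\<ge>m. \<forall>j\<ge>m. M (X i - X j) < e"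
  have XD: "X n \<in> D" for n using X by simp
  have diff: "cmod (\<Phi> (X i) y - \<Phi> (X j) y) \<le> M (X i - X j) * N y" if "y \<in> D" for i j y
    using \<Phi>_le_M[OF csub_diff[OF D XD XD] that] diff_left[OF XD that XD] by simp
  have "convergent (\<lambda>n. \<Phi> (X n) y)" if y: "y \<in> D" for y
  proof (rule Cauchy_convergent, rule metric_CauchyI)
    fix e :: real assume e: "e > 0"
    have Ny: "N y \<ge> 0" using norm_onD(1)[OF N y] .
    \<comment> \<open>The summand 1 keeps the divisor positive when \<open>N y = 0\<close>.\<close>
    then obtain m where m: "\<forall>i\<ge>m. \<forall>j\<ge>m. M (X i - X j) < e / (N y + 1)"
      using Cau e by (meson add_nonneg_pos divide_pos_pos zero_less_one)
    have "dist (\<Phi> (X i) y) (\<Phi> (X j) y) < e" if "i \<ge> m" "j \<ge> m" for i j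
    proof -
      have "M (X i - X j) * N y \<le> e / (N y + 1) * N y"
        using m that Ny by (intro mult_right_mono) (auto intro: less_imp_le)
      also have "\<dots> < e" using e Ny by (simp add: divide_less_eq)
      finally show ?thesis using diff[OF y, of i j] by (simp add: dist_norm)
    qed
    then show "\<exists>m. \<forall>i\<ge>m. \<forall>j\<ge>m. dist (\<Phi> (X i) y) (\<Phi> (X j) y) < e" by blast
  qed
  then obtain l where l: "\<And>y. y \<in> D \<Longrightarrow> (\<lambda>n. \<Phi> (X n) y) \<longlonglongrightarrow> l y"
    unfolding convergent_def by metis
  \<comment> \<open>Membership in \<open>conj_dual_on\<close> demands the value zero off
    \<open>D\<close>.\<close>
  define f where "f y = (if y \<in> D then l y else 0)" for y
  have flim: "(\<lambda>n. \<Phi> (X n) y) \<longlonglongrightarrow> f y" if "y \<in> D" for y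
    using l that by (simp add: f_def)
  \<comment> \<open>The tail stays within distance 1 of \<open>X m1\<close>, so
    \<open>M (X m1) + 1\<close> bounds it and hence the limit functional.\<close>
  obtain m1 where m1: "\<And>n. n \<ge> m1 \<Longrightarrow> M (X n - X m1) < 1"
    using Cau by (metis order_refl zero_less_one)
  have "f \<in> conj_dual_on D N"
    unfolding conj_dual_on_def
  proof (intro CollectI conjI ballI allI impI)
    show "f (x + y) = f x + f y" if "x \<in> D" "y \<in> D" for x y
      using LIMSEQ_unique[OF flim[OF csub_add[OF D that]]] tendsto_add[OF flim[OF that(1)] flim[OF that(2)]]
        sesquilinear_onD(3)[OF sesquilinear XD that] by simp
    show "f (c *\<^sub>C x) = cnj c * f x" if "x \<in> D" for c x
      using LIMSEQ_unique[OF flim[OF csub_scale[OF D that]]] tendsto_mult[OF tendsto_const flim[OF that]]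
        sesquilinear_onD(4)[OF sesquilinear XD that] by simp
    show "f x = 0" if "x \<notin> D" for x using that by (simp add: f_def)
    have "cmod (f y) \<le> (M (X m1) + 1) * N y" if y: "y \<in> D" for y
    proof (rule LIMSEQ_le_const2[OF tendsto_norm[OF flim[OF y]]])
      have "cmod (\<Phi> (X n) y) \<le> (M (X m1) + 1) * N y" if "n \<ge> m1" for n
      proof -
        have "M (X n) \<le> M (X n - X m1) + M (X m1)"
          using norm_onD(5)[OF M_norm csub_diff[OF D XD XD] XD, of n m1 m1] by simp
        then have "M (X n) * N y \<le> (M (X m1) + 1) * N y"
          using m1[OF that] norm_onD(1)[OF N y] by (intro mult_right_mono) auto
        then show ?thesis using \<Phi>_le_M[OF XD y, of n] by linarith
      qed
      then show "\<exists>k. \<forall>n\<ge>k. cmod (\<Phi> (X n) y) \<le> (M (X m1) + 1) * N y" by blast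
    qed
    then show "\<exists>K. \<forall>y\<in>D. cmod (f y) \<le> K * N y" by blast
  qed
  then obtain x where x: "x \<in> D" "\<And>y. y \<in> D \<Longrightarrow> f y = \<Phi> x y"
    using \<Phi>_represents by blast
  have "(\<lambda>n. M (X n - x)) \<longlonglongrightarrow> 0"
    unfolding LIMSEQ_iff
  proof (intro allI impI)
    fix e :: real assume e: "e > 0"
    then obtain m where m: "\<forall>i\<ge>m. \<forall>j\<ge>m. M (X i - X j) < e/2"
      using Cau half_gt_zero by blast
    have "norm (M (X n - x) - 0) < e" if n: "n \<ge> m" for n
    proof -
      \<comment> \<open>The Cauchy estimate is uniform in \<open>y\<close>; letting \<open>j\<close>
        tend to infinity keeps the bound \<open>e/2\<close> in non-strict form.\<close>
      have "M (X n - x) \<le> e/2"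
      proof (rule M_leI)
        fix y assume y: "y \<in> D"
        have "(\<lambda>j. cmod (\<Phi> (X n) y - \<Phi> (X j) y)) \<longlonglongrightarrow> cmod (\<Phi> (X n) y - f y)"
          by (intro tendsto_intros flim y)
        moreover have "cmod (\<Phi> (X n) y - \<Phi> (X j) y) \<le> e/2 * N y" if "j \<ge> m" for j
          using diff[OF y, of n j] m n that norm_onD(1)[OF N y]
            mult_right_mono[of "M (X n - X j)" "e/2" "N y"] by force
        ultimately have "cmod (\<Phi> (X n) y - f y) \<le> e/2 * N y"
          by (intro LIMSEQ_le_const2) blast+
        then show "cmod (\<Phi> (X n - x) y) \<le> e/2 * N y"
          using diff_left[OF XD y x(1), of n] x(2)[OF y] by simp
      qed (use e in simp)
      then show ?thesis using e M_nonneg[OF csub_diff[OF D XD x(1)], of n] by simp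
    qed
    then show "\<exists>m. \<forall>n\<ge>m. norm (M (X n - x) - 0) < e" by blast
  qed
  then show "\<exists>x\<in>D. (\<lambda>n. M (X n - x)) \<longlonglongrightarrow> 0" using x(1) by blast
qed

text \<open>Boundedness of \<open>\<Phi>\<close> makes \<open>M\<close> at most a multiple of
  \<open>N\<close>; both norms are complete, so they are equivalent. This is the boundedness of the
  inverse of \<open>x \<mapsto> \<Phi> x\<close>.\<close>

lemma N_le_M: "\<exists>K\<ge>0. \<forall>x\<in>D. N x \<le> K * M x"
proof -
  obtain b where b: "b \<ge> 0" "\<And>x y. x \<in> D \<Longrightarrow> y \<in> D \<Longrightarrow> cmod (\<Phi> x y) \<le> b * N x * N y"
    using bounded by blast
  have "M x \<le> b * N x" if "x \<in> D" for x
    using b that norm_onD(1)[OF N that] by (intro M_leI) auto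
  moreover have "banach_on D N" using q_closed by (simp add: q_closed_def)
  ultimately obtain K where K: "\<And>x. x \<in> D \<Longrightarrow> N x \<le> K * M x"
    using complete_norms_equivalent[OF D N M_norm _ M_complete] by blast
  have "K * M x \<le> \<bar>K\<bar> * M x" if "x \<in> D" for x
    using M_nonneg[OF that] by (intro mult_right_mono) auto
  then show ?thesis using K by (intro exI[of _ "\<bar>K\<bar>"]) (auto intro: order_trans)
qed

text \<open>Reflexivity makes the adjoint of the isomorphism \<open>x \<mapsto> \<Phi> x\<close> surjective: the \<open>y\<close> sought
  represents the bidual functional taking \<open>f = cnj \<circ> \<Phi> x\<close> to \<open>cnj (g x)\<close>.\<close>

lemma \<Phi>_represents_dual:
  assumes g: "g \<in> dual_on D N"
  shows "\<exists>y\<in>D. \<forall>x\<in>D. \<Phi> x y = g x"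
proof -
  have g_add: "g (x + y) = g x + g y" and g_scale: "g (c *\<^sub>C x) = c * g x" if "x \<in> D" "y \<in> D" for x y c
    using g that by (simp_all add: dual_on_def)
  obtain Kg where Kg: "\<And>x. x \<in> D \<Longrightarrow> cmod (g x) \<le> Kg * N x"
    using g unfolding dual_on_def by blast
  obtain K where K: "K \<ge> 0" "\<And>x. x \<in> D \<Longrightarrow> N x \<le> K * M x"
    using N_le_M by blast
  have "\<exists>x\<in>D. \<forall>y\<in>D. \<Phi> x y = cnj (f y)" if "f \<in> dual_on D N" for f
  proof -
    have "(\<lambda>y. cnj (f y)) \<in> conj_dual_on D N"
      using that by (auto simp: dual_on_def conj_dual_on_def)
    then show ?thesis using \<Phi>_represents by metis
  qed
  then obtain R where R: "\<And>f. f \<in> dual_on D N \<Longrightarrow> R f \<in> D"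
      "\<And>f y. f \<in> dual_on D N \<Longrightarrow> y \<in> D \<Longrightarrow> \<Phi> (R f) y = cnj (f y)"
    by metis
  \<comment> \<open>Uniqueness makes \<open>R\<close> conjugate linear, so
    \<open>cnj (g (R f))\<close> is linear in \<open>f\<close>.\<close>
  have R_eq: "R f = x" if "f \<in> dual_on D N" "x \<in> D" "\<And>y. y \<in> D \<Longrightarrow> \<Phi> x y = cnj (f y)" for f x
    using that R by (intro \<Phi>_eq_imp_eq) auto
  have dual_add: "(\<lambda>x. f x + h x) \<in> dual_on D N" if fh: "f \<in> dual_on D N" "h \<in> dual_on D N" for f h
  proof -
    obtain Kf where Kf: "\<And>x. x \<in> D \<Longrightarrow> cmod (f x) \<le> Kf * N x"
      using fh(1) unfolding dual_on_def by blast
    obtain Kh where Kh: "\<And>x. x \<in> D \<Longrightarrow> cmod (h x) \<le> Kh * N x"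
      using fh(2) unfolding dual_on_def by blast
    have "cmod (f x + h x) \<le> (Kf + Kh) * N x" if "x \<in> D" for x
      using Kf[OF that] Kh[OF that] norm_triangle_ineq[of "f x" "h x"] by (simp add: distrib_right)
    then have "\<exists>K. \<forall>x\<in>D. cmod (f x + h x) \<le> K * N x" by blast
    then show ?thesis using fh by (simp add: dual_on_def distrib_left)
  qed
  have dual_scale: "(\<lambda>x. c * f x) \<in> dual_on D N" if f: "f \<in> dual_on D N" for f c
  proof -
    obtain Kf where "\<And>x. x \<in> D \<Longrightarrow> cmod (f x) \<le> Kf * N x"
      using f unfolding dual_on_def by blast
    then have "cmod (c * f x) \<le> (cmod c * Kf) * N x" if "x \<in> D" for x
      using that by (simp add: norm_mult mult.assoc mult_left_mono)
    then have "\<exists>K. \<forall>x\<in>D. cmod (c * f x) \<le> K * N x" by blast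
    then show ?thesis using f by (simp add: dual_on_def distrib_left)
  qed
  have bidual: "(\<lambda>f. cnj (g (R f))) \<in> bidual_on D N"
    unfolding bidual_on_def
  proof (intro CollectI conjI ballI allI)
    fix f h assume fh: "f \<in> dual_on D N" "h \<in> dual_on D N"
    have "R (\<lambda>x. f x + h x) = R f + R h"
      using fh R sesquilinear_onD(1)[OF sesquilinear] by (intro R_eq dual_add csub_add[OF D]) auto
    then show "cnj (g (R (\<lambda>x. f x + h x))) = cnj (g (R f)) + cnj (g (R h))"
      using g_add R fh by simp
  next
    fix c f assume f: "f \<in> dual_on D N"
    have "R (\<lambda>x. c * f x) = cnj c *\<^sub>C R f"
      using f R sesquilinear_onD(2)[OF sesquilinear] by (intro R_eq dual_scale csub_scale[OF D]) auto
    then show "cnj (g (R (\<lambda>x. c * f x))) = c * cnj (g (R f))"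
      using g_scale[OF R(1)[OF f] R(1)[OF f]] by simp
  next
    have "cmod (cnj (g (R f))) \<le> \<bar>Kg\<bar> * K * dual_norm_on D N f" if f: "f \<in> dual_on D N" for f
    proof -
      \<comment> \<open>On \<open>D\<close> the absolute values of \<open>f\<close> and
        \<open>\<Phi> (R f)\<close> agree, so the estimate of \<open>N\<close> by \<open>M\<close>
        bounds the functional.\<close>
      have "dual_norm_on D N f = M (R f)"
        unfolding M_def dual_norm_on_def using R[OF f] by (intro SUP_cong) auto
      moreover have "cmod (g (R f)) \<le> \<bar>Kg\<bar> * N (R f)"
        using Kg[OF R(1)[OF f]] mult_right_mono[OF abs_ge_self norm_onD(1)[OF N R(1)[OF f]], of Kg] by linarith
      moreover have "\<bar>Kg\<bar> * N (R f) \<le> \<bar>Kg\<bar> * (K * M (R f))"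
        using K(2)[OF R(1)[OF f]] by (intro mult_left_mono) auto
      ultimately show ?thesis by (simp add: mult.assoc)
    qed
    then show "\<exists>K. \<forall>f\<in>dual_on D N. cmod (cnj (g (R f))) \<le> K * dual_norm_on D N f" by blast
  qed
  have "reflexive_on D N" using q_closed by (simp add: q_closed_def)
  then have "\<exists>y\<in>D. \<forall>f\<in>dual_on D N. cnj (g (R f)) = f y"
    unfolding reflexive_on_def using bidual by (rule bspec)
  then obtain y where y: "y \<in> D" "\<And>f. f \<in> dual_on D N \<Longrightarrow> cnj (g (R f)) = f y"
    by blast
  have "\<Phi> x y = g x" if x: "x \<in> D" for x
  proof -
    \<comment> \<open>This is the functional with \<open>R f = x\<close>; evaluating the bidual
      identity at it gives the claim up to conjugation.\<close>
    define f where "f z = (if z \<in> D then cnj (\<Phi> x z) else 0)" for z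
    have "\<exists>K. \<forall>z\<in>D. cmod (\<Phi> x z) \<le> K * N z" using \<Phi>_le_M[OF x] by blast
    then have f: "f \<in> dual_on D N"
      using x csub_add[OF D] csub_scale[OF D] sesquilinear_onD(3,4)[OF sesquilinear x]
      by (simp add: dual_on_def f_def)
    have "R f = x" using f x by (intro R_eq) (auto simp: f_def)
    then show ?thesis using y(2)[OF f] y(1) by (simp add: f_def)
  qed
  then show ?thesis using y(1) by blast
qed

section \<open>Representing vectors and surjectivity of the perturbed operator\<close>

text \<open>The conjugate of \<open>Y x\<close> is a bounded linear functional, so Riesz applies;
  \<open>b\<close> is the value \<open>B x\<close> of the operator belonging to
  \<open>Y\<close>.\<close>

lemma Y_left: "\<exists>b. \<forall>y. Y x y = cinner b y"
proof -
  obtain K where K: "K \<ge> 0" "\<And>x y. cmod (Y x y) \<le> K * norm x * norm y"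
    using Y_bounded by blast
  have "\<exists>b. \<forall>y. cnj (Y x y) = cinner y b"
    using K(2)[of x] sesquilinear_onD(3,4)[OF Y_sesquilinear]
    by (intro Riesz_representation[of _ "K * norm x"]) auto
  then obtain b where b: "\<And>y. cnj (Y x y) = cinner y b" by blast
  have "Y x y = cinner b y" for y
    unfolding cinner_commute[of b y] by (simp flip: b)
  then show ?thesis by blast
qed

text \<open>Riesz applied in the first argument; \<open>w\<close> is the value at \<open>y\<close>
  of the adjoint of \<open>B\<close>.\<close>

lemma Y_right: "\<exists>w. \<forall>x. Y x y = cinner x w"
proof -
  obtain K where K: "K \<ge> 0" "\<And>x y. cmod (Y x y) \<le> K * norm x * norm y"
    using Y_bounded by blast
  show ?thesis
    using K(2)[of _ y] sesquilinear_onD(1,2)[OF Y_sesquilinear]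
    by (intro Riesz_representation[of _ "K * norm y"]) (auto simp: mult_ac)
qed

lemma cinner_bound: "\<exists>K. \<forall>x\<in>D. cmod (cinner x w) \<le> K * N x"
proof -
  obtain a where a: "a > 0" "\<And>x. x \<in> D \<Longrightarrow> norm x \<le> a * N x"
    using norm_le by blast
  have "cmod (cinner x w) \<le> (a * norm w) * N x" if "x \<in> D" for x
    using cinner_Cauchy_Schwarz[of x w] mult_right_mono[OF a(2)[OF that] norm_ge_zero[of w]]
    by (simp add: mult_ac)
  then show ?thesis by blast
qed

text \<open>Surjectivity of \<open>T + B\<close>: if \<open>\<Phi> x\<close> represents
  \<open>cinner z\<close>, then \<open>T x = z - B x\<close>. The last identity holds on the whole
  space, as required for a \<open>y\<close> not yet known to lie in \<open>D\<close>.\<close>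

lemma exists_form_dom: "\<exists>x\<in>form_dom D W. (\<forall>y\<in>D. \<Phi> x y = cinner z y)
    \<and> (\<forall>y. cinner (form_op D W x) y + Y x y = cinner z y)"
proof -
  define f where "f y = (if y \<in> D then cinner z y else 0)" for y
  have "\<exists>K. \<forall>y\<in>D. cmod (cinner z y) \<le> K * N y"
    using cinner_bound[of z] cinner_commute[of z] by (metis complex_mod_cnj)
  then have "f \<in> conj_dual_on D N"
    using csub_add[OF D] csub_scale[OF D]
    by (simp add: conj_dual_on_def f_def cinner_add_right cinner_scaleC_right)
  then obtain x where x: "x \<in> D" "\<And>y. y \<in> D \<Longrightarrow> cinner z y = \<Phi> x y"
    using \<Phi>_represents by (metis f_def)
  obtain b where b: "\<And>y. Y x y = cinner b y" using Y_left by blast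
  have W: "W x y = cinner (z - b) y" if "y \<in> D" for y
    using x(2)[OF that] b by (simp add: \<Phi>_def cinner_diff_left)
  then have "x \<in> form_dom D W" using x(1) by (auto simp: form_dom_def)
  moreover have "form_op D W x = z - b" using W by (rule form_op_eqI[OF closure_D])
  ultimately show ?thesis using x(2) b by (intro bexI[of _ x]) (auto simp: cinner_diff_left)
qed

text \<open>Test with the \<open>x\<close> that \<open>T + B\<close> maps to
  \<open>y - y'\<close>.\<close>

lemma eq_if_eq_on_form_dom:
  assumes "y \<in> D" "y' \<in> D" "\<And>x. x \<in> form_dom D W \<Longrightarrow> \<Phi> x y = \<Phi> x y'"
  shows "y = y'"
proof -
  obtain x where x: "x \<in> form_dom D W" "\<And>v. v \<in> D \<Longrightarrow> \<Phi> x v = cinner (y - y') v"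
    using exists_form_dom by blast
  have "cinner (y - y') (y - y') = 0"
    using x(2)[OF assms(1)] x(2)[OF assms(2)] assms(3)[OF x(1)] by (simp add: cinner_diff_right)
  then show ?thesis by (simp add: cinner_eq_zero_iff)
qed

lemma \<Phi>_represents_linear:
  assumes "\<And>x y. x \<in> D \<Longrightarrow> y \<in> D \<Longrightarrow> g (x + y) = g x + g y"
    and "\<And>c x. x \<in> D \<Longrightarrow> g (c *\<^sub>C x) = c * g x"
    and "\<exists>K. \<forall>x\<in>D. cmod (g x) \<le> K * N x"
  shows "\<exists>y\<in>D. \<forall>x\<in>D. \<Phi> x y = g x"
proof -
  have "(\<lambda>x. if x \<in> D then g x else 0) \<in> dual_on D N"
    using assms csub_add[OF D] csub_scale[OF D] by (simp add: dual_on_def)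
  from \<Phi>_represents_dual[OF this] show ?thesis by simp
qed

lemma \<Phi>_represents_cinner: "\<exists>y\<in>D. \<forall>x\<in>D. \<Phi> x y = cinner x w"
  using cinner_bound by (intro \<Phi>_represents_linear) (auto simp: cinner_add_left cinner_scaleC_left)

section \<open>The associated operator and its adjoint\<close>

lemma form_dom_subspace: "complex_vector.subspace (form_dom D W)"
  and form_op_add: "x \<in> form_dom D W \<Longrightarrow> y \<in> form_dom D W \<Longrightarrow>
    form_op D W (x + y) = form_op D W x + form_op D W y"
  and form_op_scale: "x \<in> form_dom D W \<Longrightarrow> form_op D W (c *\<^sub>C x) = c *\<^sub>C form_op D W x"
proof -
  let ?T = "form_op D W"
  have sub: "x \<in> D" if "x \<in> form_dom D W" for x using that form_dom_subset by blast
  have add: "W (x + y) v = cinner (?T x + ?T y) v"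
    if "x \<in> form_dom D W" "y \<in> form_dom D W" "v \<in> D" for x y v
    unfolding sesquilinear_onD(1)[OF W sub[OF that(1)] that(3) sub[OF that(2)]] cinner_add_left
      form_op_eq[OF closure_D that(1,3)] form_op_eq[OF closure_D that(2,3)] ..
  have scale: "W (c *\<^sub>C x) v = cinner (c *\<^sub>C ?T x) v"
    if "x \<in> form_dom D W" "v \<in> D" for x c v
    unfolding sesquilinear_onD(2)[OF W sub[OF that(1)] that(2)] cinner_scaleC_left
      form_op_eq[OF closure_D that] ..
  show "?T (x + y) = ?T x + ?T y" if "x \<in> form_dom D W" "y \<in> form_dom D W" for x y
    using add[OF that] by (rule form_op_eqI[OF closure_D])
  show "?T (c *\<^sub>C x) = c *\<^sub>C ?T x" if "x \<in> form_dom D W" for x c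
    using scale[OF that] by (rule form_op_eqI[OF closure_D])
  show "complex_vector.subspace (form_dom D W)"
    unfolding complex_vector.subspace_def
  proof (intro conjI ballI allI)
    have "W 0 v = cinner 0 v" if "v \<in> D" for v
      using sesquilinear_onD(2)[OF W csub_0[OF D] that, of 0] by simp
    then show "0 \<in> form_dom D W" using csub_0[OF D] unfolding form_dom_def by blast
    show "x + y \<in> form_dom D W" if "x \<in> form_dom D W" "y \<in> form_dom D W" for x y
      using add[OF that] csub_add[OF D] that form_dom_subset[of D W]
      unfolding form_dom_def by blast
    show "c *\<^sub>C x \<in> form_dom D W" if "x \<in> form_dom D W" for x c
      using scale[OF that] csub_scale[OF D] that form_dom_subset[of D W]
      unfolding form_dom_def by blast
  qed
qed

text \<open>For \<open>v\<close> orthogonal to the domain, the \<open>y\<close> representing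
  \<open>cinner x v\<close> as \<open>\<Phi> x y\<close> agrees with 0 on the domain, so
  \<open>y = 0\<close> and \<open>v\<close> is orthogonal to the dense set \<open>D\<close>.\<close>

lemma form_dom_dense: "dense_subspace (form_dom D W)"
proof (rule dense_subspace_orthogonalI[OF form_dom_subspace])
  fix v assume v: "\<And>x. x \<in> form_dom D W \<Longrightarrow> cinner x v = 0"
  obtain y where y: "y \<in> D" "\<And>x. x \<in> D \<Longrightarrow> \<Phi> x y = cinner x v"
    using \<Phi>_represents_cinner by blast
  have zero: "\<Phi> x 0 = 0" if "x \<in> D" for x
    using diff_right[OF that csub_0[OF D] csub_0[OF D]] by simp
  have "y = 0"
    using y v zero form_dom_subset[of D W] csub_0[OF D] by (intro eq_if_eq_on_form_dom) auto
  then have "cinner x v = cinner x 0" if "x \<in> D" for x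
    using y(2)[OF that] zero[OF that] by simp
  then have "cinner v x = cinner 0 x" if "x \<in> D" for x
    using that cinner_commute[of v x] by simp
  then show "v = 0" by (rule dense_cinner_eq[OF closure_D])
qed

lemma form_op_densely_defined: "densely_defined_operator (form_dom D W) (form_op D W)"
  unfolding densely_defined_operator_def
  using form_dom_dense form_op_add form_op_scale by blast

text \<open>The hypothesis places \<open>y\<close> in the domain of the adjoint with value
  \<open>z\<close>. The goal is to identify \<open>y\<close> with the element \<open>y'\<close> of
  \<open>D\<close> that represents \<open>cinner x (z + w)\<close>, where \<open>w\<close> accounts
  for \<open>Y\<close>.\<close>

lemma adjoint_form_op:
  assumes "\<And>x. x \<in> form_dom D W \<Longrightarrow> cinner (form_op D W x) y = cinner x z"
  shows "y \<in> D" and "x \<in> D \<Longrightarrow> W x y = cinner x z"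
proof -
  obtain w where w: "\<And>x. Y x y = cinner x w" using Y_right by blast
  obtain y' where y': "y' \<in> D" "\<And>x. x \<in> D \<Longrightarrow> \<Phi> x y' = cinner x (z + w)"
    using \<Phi>_represents_cinner by blast
  obtain x where x: "x \<in> form_dom D W" "\<And>v. v \<in> D \<Longrightarrow> \<Phi> x v = cinner (y - y') v"
    "\<And>v. cinner (form_op D W x) v + Y x v = cinner (y - y') v"
    using exists_form_dom by blast
  \<comment> \<open>Pairing \<open>(T + B) x = y - y'\<close> with \<open>y\<close> uses the
    identity on the whole space; pairing with \<open>y'\<close> uses the one on \<open>D\<close>.
    Both give the same value.\<close>
  have "cinner (y - y') y = cinner x (z + w)"
    using x(3)[of y] assms[OF x(1)] w by (simp add: cinner_add_right)
  also have "\<dots> = cinner (y - y') y'"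
    using y'(2)[of x] x(1) x(2)[OF y'(1)] form_dom_subset[of D W] by auto
  finally have "cinner (y - y') (y - y') = 0"
    by (simp add: cinner_diff_right)
  then have eq: "y = y'" by (simp add: cinner_eq_zero_iff)
  then show "y \<in> D" using y' by simp
  show "W x y = cinner x z" if "x \<in> D" for x
    using y'(2)[OF that] w eq by (simp add: \<Phi>_def cinner_add_right)
qed

section \<open>The two implications\<close>

lemma symmetric_imp_self_adjoint:
  assumes sym: "symmetric_on D W"
  shows "self_adjoint (form_dom D W) (form_op D W)"
proof -
  let ?S = "form_dom D W" and ?T = "form_op D W"
  have symT: "cinner (?T x) y = cinner x (?T y)" if xy: "x \<in> ?S" "y \<in> ?S" for x y
  proof -
    have D': "x \<in> D" "y \<in> D" using xy form_dom_subset by blast+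
    have "cinner (?T x) y = cnj (W y x)"
      using form_op_eq[OF closure_D xy(1) D'(2)] sym D' unfolding symmetric_on_def by metis
    also have "\<dots> = cinner x (?T y)"
      using form_op_eq[OF closure_D xy(2) D'(1)] cinner_commute[of x "?T y"] by simp
    finally show ?thesis .
  qed
  have "adjoint_dom ?S ?T \<subseteq> ?S"
  proof
    fix y assume "y \<in> adjoint_dom ?S ?T"
    then obtain z where z: "\<And>x. x \<in> ?S \<Longrightarrow> cinner (?T x) y = cinner x z"
      by (auto simp: adjoint_dom_def)
    \<comment> \<open>Symmetry on all of \<open>D\<close> moves \<open>y\<close> to the first
      argument, where the identity is the defining property of the domain of
      \<open>T\<close>.\<close>
    have "W y x = cinner z x" if "x \<in> D" for x
    proof -
      have "W y x = cnj (W x y)"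
        using sym adjoint_form_op(1)[OF z] that unfolding symmetric_on_def by blast
      then show ?thesis
        using adjoint_form_op(2)[OF z that] cinner_commute[of z x] by simp
    qed
    then show "y \<in> ?S" using adjoint_form_op(1)[OF z] unfolding form_dom_def by blast
  qed
  moreover have "?S \<subseteq> adjoint_dom ?S ?T"
    unfolding adjoint_dom_def using symT by blast
  moreover have "adjoint_op ?S ?T y = ?T y" if "y \<in> ?S" for y
    using symT that form_dom_dense by (intro adjoint_op_eqI) auto
  ultimately show ?thesis
    unfolding self_adjoint_def using form_op_densely_defined by blast
qed

lemma self_adjoint_imp_symmetric:
  assumes sa: "self_adjoint (form_dom D W) (form_op D W)"
  shows "symmetric_on D W"
  unfolding symmetric_on_def
proof (intro ballI)
  let ?S = "form_dom D W" and ?T = "form_op D W"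
  have symT: "cinner (?T x) y = cinner x (?T y)" if "x \<in> ?S" "y \<in> ?S" for x y
    using adjoint_op_eq[of ?S y ?T x] that sa form_dom_dense by (simp add: self_adjoint_def)
  \<comment> \<open>Self-adjointness makes \<open>T y\<close> the adjoint value at \<open>y\<close>,
    and \<open>adjoint_form_op\<close> extends the identity from the domain of \<open>T\<close> to
    all \<open>x\<close> in \<open>D\<close>.\<close>
  have half: "W x y = cnj (W y x)" if "x \<in> D" "y \<in> ?S" for x y
  proof -
    have "W x y = cinner x (?T y)"
      using symT that by (intro adjoint_form_op(2)) auto
    also have "\<dots> = cnj (W y x)"
      using form_op_eq[OF closure_D that(2,1)] cinner_commute[of x "?T y"] by simp
    finally show ?thesis .
  qed
  fix x y assume x: "x \<in> D" and y: "y \<in> D"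
  obtain b where b: "\<And>u v. u \<in> D \<Longrightarrow> v \<in> D \<Longrightarrow> cmod (W u v) \<le> b * N u * N v"
    using q_closed unfolding q_closed_def by blast
  obtain w where w: "\<And>x. Y x y = cinner x w" using Y_right by blast
  obtain K where K: "\<And>u. u \<in> D \<Longrightarrow> cmod (cinner u w) \<le> K * N u"
    using cinner_bound by blast
  txt \<open>If the form is symmetric, \<open>y\<close> itself represents this functional.\<close>
  have "\<exists>y'\<in>D. \<forall>u\<in>D. \<Phi> u y' = cnj (W y u) + cinner u w"
  proof (rule \<Phi>_represents_linear)
    have "cmod (cnj (W y u) + cinner u w) \<le> (b * N y + K) * N u" if "u \<in> D" for u
      using b[OF y that] K[OF that] norm_triangle_ineq[of "cnj (W y u)" "cinner u w"]
      by (simp add: distrib_right)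
    then show "\<exists>K. \<forall>u\<in>D. cmod (cnj (W y u) + cinner u w) \<le> K * N u" by blast
  qed (use sesquilinear_onD(3,4)[OF W y] in \<open>simp_all add: cinner_add_left cinner_scaleC_left distrib_left\<close>)
  then obtain y' where y': "y' \<in> D" "\<And>u. u \<in> D \<Longrightarrow> \<Phi> u y' = cnj (W y u) + cinner u w"
    by blast
  \<comment> \<open>For \<open>u\<close> in the domain, \<open>half\<close> identifies
    \<open>cnj (W y u)\<close> with \<open>W u y\<close>, so \<open>y\<close> and \<open>y'\<close>
    give the same values \<open>\<Phi> u y\<close> there.\<close>
  have "y' = y"
  proof (rule eq_if_eq_on_form_dom[OF y'(1) y])
    fix u assume u: "u \<in> ?S"
    then have "u \<in> D" using form_dom_subset by blast
    then show "\<Phi> u y' = \<Phi> u y"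
      using y'(2) half[OF y u] w by (simp add: \<Phi>_def)
  qed
  then show "W x y = cnj (W y x)"
    using y'(2)[OF x] w by (simp add: \<Phi>_def)
qed

end

theorem corollary4p14:
  fixes D :: "'a::complex_hilbert set" and \<Omega> :: "'a \<Rightarrow> 'a \<Rightarrow> complex"
  assumes "dense_subspace D"
    and "sesquilinear_on D \<Omega>"
    and "solvable D \<Omega>"
  shows "self_adjoint (form_dom D \<Omega>) (form_op D \<Omega>) \<longleftrightarrow> symmetric_on D \<Omega>"
proof -
  obtain N Y where "norm_on D N" "q_closed D \<Omega> N" "Y \<in> perturbations D \<Omega> N"
    using assms(3) by (auto simp: solvable_def solvable_wrt_def)
  then interpret perturbed_form D N \<Omega> Y
    using assms(1,2) by unfold_locales
  show ?thesis
    using symmetric_imp_self_adjoint self_adjoint_imp_symmetric by blast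
qed

end
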